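(* For every $(\varphi,x)\in\mathbb L_p(-2T,0)\times\mathbb R^N$ there exists a unique solution on $[-2T,\infty)$ of the hysteresis-delay problem $$u'(t)=k\,\mathcal H(\mathbf M u)(t)-\mathbf B u(t)+\mathbf A u(t-2T)\ (t>0),\qquad u(t)=\varphi(t)\ (t\in(-2T,0)),\qquad u(0+)=x.$$
   Context: Fix $N\ge 1$, $1<p<\infty$, $T>0$, real numbers $\alpha<\beta$, $k\in\mathbb R^N$, $\mathbf A,\mathbf B\in\mathbb R^{N\times N}$, and a linear functional $\mathbf M=(m_0,\dots,m_{N-1})$ on $\mathbb R^N$, $\mathbf Mx=\sum_{j=1}^N m_{j-1}x_j$, with $m_0\ne 0$. Write $\mathbb L_p(a,b)=(L_p(a,b))^N$ and $\mathbb W^1_p(a,b)=(W^1_p(a,b))^N$ (Sobolev space). Hysteresis operator: for $g\in C[0,T_1]$, $T_1>0$, the function $z=\mathcal H(g):[0,T_1]\to\{-1,1\}$ is defined as follows. Let $X_t=\{t'\in(0,t]: g(t')=\alpha\text{ or }\beta\}$. Then $z(0)=1$ if $g(0)<\beta$ and $z(0)=-1$ if $g(0)\ge\beta$; for $t>0$, $z(t)=z(0)$ if $X_t=\emptyset$, $z(t)=1$ if $X_t\neq\emptyset$ and $g(\max X_t)=\alpha$, $z(t)=-1$ if $X_t\ne\emptyset$ and $g(\max X_t)=\beta$. Solution: given $T_1>0$, a function $u\in\mathbb L_p(-2T,T_1)$ with $u|_{(0,T_1)}\in\mathbb W^1_p(0,T_1)$ is a solution on $[-2T,T_1]$ with initial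 data $(\varphi,x)$ if the differential equation holds for a.e. $t\in(0,T_1)$, $u=\varphi$ a.e. on $(-2T,0)$, and $u(0+)=x$ in the sense of traces. A function is a solution on $[-2T,\infty)$ if it is a solution on $[-2T,T_1]$ for every $T_1>0$. *)

theory Defs
  imports "HOL-Analysis.Analysis"
begin

text \<open>
  Elements of Lebesgue and Sobolev spaces are represented by functions on the whole real line;
  only their values almost everywhere on the interval in question matter.
\<close>

definition Lp :: "real \<Rightarrow> real \<Rightarrow> real \<Rightarrow> (real \<Rightarrow> real) set" where
  "Lp p a b = {f. f \<in> borel_measurable (lebesgue_on {a<..<b}) \<and>
     integrable (lebesgue_on {a<..<b}) (\<lambda>t. \<bar>f t\<bar> powr p)}"

definition test_function :: "real \<Rightarrow> real \<Rightarrow> (real \<Rightarrow> real) \<Rightarrow> bool" where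
  "test_function a b \<psi> \<longleftrightarrow>
     (\<forall>n. (deriv ^^ n) \<psi> differentiable_on UNIV) \<and>
     compact (closure {t. \<psi> t \<noteq> 0}) \<and> closure {t. \<psi> t \<noteq> 0} \<subseteq> {a<..<b}"

text \<open>Both functions are required to be in \<open>L\<^sub>p\<close>, so the integrals below are never the default
  value \<open>0\<close> of a non-integrable integrand.\<close>

definition sobolev_deriv :: "real \<Rightarrow> real \<Rightarrow> real \<Rightarrow> (real \<Rightarrow> real) \<Rightarrow> (real \<Rightarrow> real) \<Rightarrow> bool" where
  "sobolev_deriv p a b f g \<longleftrightarrow> f \<in> Lp p a b \<and> g \<in> Lp p a b \<and>
     (\<forall>\<psi>. test_function a b \<psi> \<longrightarrow>
       (LINT t|lebesgue_on {a<..<b}. f t * deriv \<psi> t) =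
       - (LINT t|lebesgue_on {a<..<b}. g t * \<psi> t))"

definition W1p :: "real \<Rightarrow> real \<Rightarrow> real \<Rightarrow> (real \<Rightarrow> real) set" where
  "W1p p a b = {f. \<exists>g. sobolev_deriv p a b f g}"

definition Lp_vec :: "real \<Rightarrow> real \<Rightarrow> real \<Rightarrow> (real \<Rightarrow> real ^ 'n) set" where
  "Lp_vec p a b = {u. \<forall>i. (\<lambda>t. u t $ i) \<in> Lp p a b}"

definition W1p_vec :: "real \<Rightarrow> real \<Rightarrow> real \<Rightarrow> (real \<Rightarrow> real ^ 'n) set" where
  "W1p_vec p a b = {u. \<forall>i. (\<lambda>t. u t $ i) \<in> W1p p a b}"

definition sobolev_deriv_vec ::
    "real \<Rightarrow> real \<Rightarrow> real \<Rightarrow> (real \<Rightarrow> real ^ 'n) \<Rightarrow> (real \<Rightarrow> real ^ 'n) \<Rightarrow> bool" where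
  "sobolev_deriv_vec p a b u w \<longleftrightarrow> (\<forall>i. sobolev_deriv p a b (\<lambda>t. u t $ i) (\<lambda>t. w t $ i))"

definition continuous_rep ::
    "real \<Rightarrow> real \<Rightarrow> (real \<Rightarrow> 'a::real_normed_vector) \<Rightarrow> (real \<Rightarrow> 'a) \<Rightarrow> bool" where
  "continuous_rep a b f g \<longleftrightarrow>
     continuous_on {a..b} g \<and> (AE t in lebesgue_on {a<..<b}. g t = f t)"

text \<open>The trace of a \<open>W\<^sup>1\<^sub>p(a,b)\<close> function at \<open>a+\<close> is the value at \<open>a\<close> of its representative
  in \<open>C[a,b]\<close>.\<close>

definition right_trace :: "real \<Rightarrow> real \<Rightarrow> (real \<Rightarrow> 'a::real_normed_vector) \<Rightarrow> 'a \<Rightarrow> bool" where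
  "right_trace a b f x \<longleftrightarrow> (\<exists>g. continuous_rep a b f g \<and> g a = x)"

text \<open>For continuous \<open>g\<close> a nonempty set of switching times in \<open>(0,t]\<close> has a maximum,
  which is what \<open>GREATEST\<close> denotes.  The value at \<open>t\<close> depends on \<open>g\<close> on \<open>[0,t]\<close> only, so the
  right end point of the domain of \<open>g\<close> is not a parameter.\<close>

definition switch_times :: "real \<Rightarrow> real \<Rightarrow> (real \<Rightarrow> real) \<Rightarrow> real \<Rightarrow> real set" where
  "switch_times \<alpha> \<beta> g t = {s. 0 < s \<and> s \<le> t \<and> (g s = \<alpha> \<or> g s = \<beta>)}"

definition hysteresis :: "real \<Rightarrow> real \<Rightarrow> (real \<Rightarrow> real) \<Rightarrow> real \<Rightarrow> real" where
  "hysteresis \<alpha> \<beta> g t =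
     (if switch_times \<alpha> \<beta> g t = {} then (if g 0 < \<beta> then 1 else -1)
      else if g (GREATEST s. s \<in> switch_times \<alpha> \<beta> g t) = \<alpha> then 1 else -1)"

text \<open>The map \<open>e\<close> enumerates the coordinates: \<open>x $ e j\<close> is the \<open>j\<close>-th coordinate of \<open>x\<close>,
  for \<open>1 \<le> j \<le> N = CARD('n)\<close>.\<close>

definition lin_functional :: "(nat \<Rightarrow> 'n) \<Rightarrow> (nat \<Rightarrow> real) \<Rightarrow> real ^ 'n \<Rightarrow> real" where
  "lin_functional e m x = (\<Sum>j = 1..CARD('n). m (j - 1) * x $ e j)"

text \<open>In the equation, \<open>w\<close> is the weak derivative of \<open>u\<close> on \<open>(0,T\<^sub>1)\<close>, and \<open>\<H>\<close> is
  applied to the representative \<open>g\<close> of \<open>\<^bold>M u\<close> in \<open>C[0,T\<^sub>1]\<close>.\<close>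

definition solution_upto ::
    "real \<Rightarrow> real \<Rightarrow> real \<Rightarrow> real \<Rightarrow> real ^ 'n \<Rightarrow> real ^ 'n ^ 'n \<Rightarrow> real ^ 'n ^ 'n \<Rightarrow>
     (real ^ 'n \<Rightarrow> real) \<Rightarrow> (real \<Rightarrow> real ^ 'n) \<Rightarrow> real ^ 'n \<Rightarrow> real \<Rightarrow> (real \<Rightarrow> real ^ 'n) \<Rightarrow> bool"
  where
  "solution_upto p T \<alpha> \<beta> k A B M \<phi> x T1 u \<longleftrightarrow>
     u \<in> Lp_vec p (- 2 * T) T1 \<and>
     u \<in> W1p_vec p 0 T1 \<and>
     (\<exists>w g. sobolev_deriv_vec p 0 T1 u w \<and>
        continuous_rep 0 T1 (\<lambda>t. M (u t)) g \<and>
        (AE t in lebesgue_on {0<..<T1}.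
           w t = hysteresis \<alpha> \<beta> g t *\<^sub>R k - B *v u t + A *v u (t - 2 * T))) \<and>
     (AE t in lebesgue_on {- 2 * T<..<0}. u t = \<phi> t) \<and>
     right_trace 0 T1 u x"

definition solution ::
    "real \<Rightarrow> real \<Rightarrow> real \<Rightarrow> real \<Rightarrow> real ^ 'n \<Rightarrow> real ^ 'n ^ 'n \<Rightarrow> real ^ 'n ^ 'n \<Rightarrow>
     (real ^ 'n \<Rightarrow> real) \<Rightarrow> (real \<Rightarrow> real ^ 'n) \<Rightarrow> real ^ 'n \<Rightarrow> (real \<Rightarrow> real ^ 'n) \<Rightarrow> bool"
  where
  "solution p T \<alpha> \<beta> k A B M \<phi> x u \<longleftrightarrow>
     (\<forall>T1 > 0. solution_upto p T \<alpha> \<beta> k A B M \<phi> x T1 u)"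

end

theory Submission imports Defs "HOL-Computational_Algebra.Polynomial" begin

text \<open>
  Given the relay state \<open>z\<close>, the problem is linear: its integrated form is a Volterra equation for
  the continuous representative of \<open>u\<close> on \<open>[0,\<infinity>)\<close>.  The Volterra operator, delay term included,
  depends on the past only and is a contraction in an exponentially weighted norm, so every measurable
  \<open>z\<close> with \<open>\<bar>z\<bar> \<le> 1\<close> has exactly one response, and the response on \<open>[0,c]\<close> depends on \<open>z\<close> on
  \<open>[0,c)\<close> only.  A solution is a \<open>z\<close> that equals the relay state generated by its own response.

  At time \<open>t\<close> the relay input is never at the threshold that would switch the current state, hence
  the state is constant on some \<open>[t,t+\<epsilon>]\<close>.  Therefore a solution up to \<open>t\<close> can be prolonged with
  constant \<open>z\<close>, and two solutions that agree up to \<open>t\<close> agree slightly longer; by causality both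
  statements also pass to limits of times.  Induction along the half-line gives existence and
  uniqueness.

  The passage from the weak formulation to the integrated one is the lemma of du Bois-Reymond;
  the converse passage is integration by parts against test functions, by Fubini's theorem.
\<close>

subsection \<open>Smooth bumps\<close>

text \<open>\<open>test_function\<close> iterates \<open>deriv\<close> from the outside. This
  recursion peels off the innermost derivative, so that inductions over sums, products and
  substitutions can pass to \<open>deriv f\<close>.\<close>

primrec times_differentiable :: "nat \<Rightarrow> (real \<Rightarrow> real) \<Rightarrow> bool" where
  "times_differentiable 0 f \<longleftrightarrow> f differentiable_on UNIV"
| "times_differentiable (Suc n) f \<longleftrightarrow> f differentiable_on UNIV \<and> times_differentiable n (deriv f)"

lemma times_differentiable_imp_differentiable:
  "times_differentiable n f \<Longrightarrow> f differentiable_on UNIV"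
  by (cases n) auto

lemma times_differentiable_Suc_imp: "times_differentiable (Suc n) f \<Longrightarrow> times_differentiable n f"
  by (induction n arbitrary: f) auto

lemma times_differentiable_imp_deriv_funpow:
  "times_differentiable n f \<Longrightarrow> (deriv ^^ n) f differentiable_on UNIV"
  by (induction n arbitrary: f) (auto simp del: funpow.simps simp add: funpow_Suc_right)

lemma times_differentiable_DERIV:
  "times_differentiable n f \<Longrightarrow> (f has_field_derivative deriv f t) (at t)"
  by (metis DERIV_deriv_iff_real_differentiable UNIV_I differentiable_on_def
      times_differentiable_imp_differentiable)

lemma times_differentiable_SucI:
  assumes "\<And>t. (f has_field_derivative g t) (at t)" "times_differentiable n g"
  shows "times_differentiable (Suc n) f"
proof -
  have "deriv f = g" using assms(1) DERIV_imp_deriv by blast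
  moreover have "f differentiable_on UNIV"
    using assms(1) real_differentiable_def unfolding differentiable_on_def by blast
  ultimately show ?thesis using assms(2) by simp
qed

lemma times_differentiable_add:
  "times_differentiable n f \<Longrightarrow> times_differentiable n g \<Longrightarrow> times_differentiable n (\<lambda>t. f t + g t)"
proof (induction n arbitrary: f g)
  case (Suc n)
  show ?case
  proof (rule times_differentiable_SucI)
    show "((\<lambda>t. f t + g t) has_field_derivative (deriv f t + deriv g t)) (at t)" for t
      using Suc.prems by (intro DERIV_add times_differentiable_DERIV)
    show "times_differentiable n (\<lambda>t. deriv f t + deriv g t)"
      using Suc by simp
  qed
qed simp

lemma times_differentiable_mult:
  "times_differentiable n f \<Longrightarrow> times_differentiable n g \<Longrightarrow> times_differentiable n (\<lambda>t. f t * g t)"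
proof (induction n arbitrary: f g)
  case (Suc n)
  show ?case
  proof (rule times_differentiable_SucI)
    show "((\<lambda>t. f t * g t) has_field_derivative (deriv f t * g t + deriv g t * f t)) (at t)" for t
      using Suc.prems by (intro DERIV_mult times_differentiable_DERIV)
    show "times_differentiable n (\<lambda>t. deriv f t * g t + deriv g t * f t)"
      using Suc times_differentiable_Suc_imp
      by (intro times_differentiable_add Suc.IH) auto
  qed
qed simp

lemma times_differentiable_const: "times_differentiable n (\<lambda>t. c)"
  by (induction n arbitrary: c) (auto simp: deriv_const[abs_def])

lemma times_differentiable_affine:
  "times_differentiable n f \<Longrightarrow> times_differentiable n (\<lambda>t. f (c * t + d))"
proof (induction n arbitrary: f)
  case 0
  then have "(f has_field_derivative deriv f t) (at t)" for t
    using times_differentiable_DERIV by blast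
  then have "((\<lambda>t. f (c * t + d)) has_field_derivative deriv f (c*t+d) * c) (at t)" for t
    by (intro DERIV_chain2[where f=f]) (auto intro!: derivative_eq_intros)
  then show ?case
    using real_differentiable_def unfolding times_differentiable.simps differentiable_on_def by blast
next
  case (Suc n)
  show ?case
  proof (rule times_differentiable_SucI)
    show "((\<lambda>t. f (c * t + d)) has_field_derivative deriv f (c*t+d) * c) (at t)" for t
      using Suc.prems times_differentiable_DERIV
      by (intro DERIV_chain2[where f=f]) (blast, auto intro!: derivative_eq_intros)
    show "times_differentiable n (\<lambda>t. deriv f (c * t + d) * c)"
      using Suc by (intro times_differentiable_mult times_differentiable_const Suc.IH) auto
  qed
qed

text \<open>This family contains \<open>\<lambda>t. exp (- 1 / t)\<close> (extended by \<open>0\<close>) and is closed under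
  differentiation.\<close>

definition flat :: "real poly \<Rightarrow> real \<Rightarrow> real" where
  "flat q t = (if t > 0 then poly q (1 / t) * exp (- (1 / t)) else 0)"

text \<open>Exponential decay beats every power. With \<open>s = 1 / t\<close> this gives the limit
  of the difference quotients of \<open>flat q\<close> at 0 from the right.\<close>

lemma poly_exp_tendsto_0: "((\<lambda>s. poly q s * exp (- s)) \<longlongrightarrow> (0::real)) at_top"
proof (induction q)
  case (pCons a q)
  have *: "((\<lambda>s. poly q s * exp (-s) * s) \<longlongrightarrow> (0::real)) at_top" for q :: "real poly"
  proof -
    have "((\<lambda>s. \<Sum>i\<le>degree q. coeff q i * (s ^ (Suc i) / exp s)) \<longlongrightarrow> (\<Sum>i\<le>degree q. coeff q i * 0)) at_top"
      by (intro tendsto_intros tendsto_power_div_exp_0)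
    then show ?thesis
      by (simp add: poly_altdef exp_minus field_simps sum_distrib_left sum_distrib_right sum_divide_distrib)
  qed
  have "((\<lambda>s. a * (s ^ 0 / exp s) + poly q s * exp (-s) * s) \<longlongrightarrow> a * 0 + 0) at_top"
    by (intro tendsto_intros tendsto_power_div_exp_0 *)
  then show ?case
    by (simp add: algebra_simps exp_minus divide_inverse)
qed simp

text \<open>With \<open>s = 1 / t\<close> one has \<open>ds/dt = - s^2\<close>, so the chain rule
  turns \<open>q s * exp (- s)\<close> into \<open>s^2 * (q s - q' s) * exp (- s)\<close>. The
  result is of the same form, hence smoothness follows by induction.\<close>

lemma flat_DERIV:
  "(flat q has_field_derivative flat ([:0,0,1:] * (q - pderiv q)) t) (at t)"
proof -
  consider "t > 0" | "t < 0" | "t = 0" by linarith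
  then show ?thesis
  proof cases
    case 1
    have "((\<lambda>t. poly q (1 / t) * exp (- (1 / t))) has_field_derivative
        flat ([:0,0,1:] * (q - pderiv q)) t) (at t)"
      using 1
      by (auto intro!: derivative_eq_intros DERIV_chain2[where f="poly q"] poly_DERIV
          simp: flat_def field_simps power2_eq_square)
    then show ?thesis
      by (rule has_field_derivative_transform_within_open[where S="{0<..}"])
        (use 1 in \<open>auto simp: flat_def\<close>)
  next
    case 2
    have "((\<lambda>t. 0) has_field_derivative flat ([:0,0,1:] * (q - pderiv q)) t) (at t)"
      using 2 by (auto simp: flat_def)
    then show ?thesis
      by (rule has_field_derivative_transform_within_open[where S="{..<0}"])
        (use 2 in \<open>auto simp: flat_def\<close>)
  next
    case 3
    \<comment> \<open>The quotient \<open>flat q h / h\<close> has one more power of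
      \<open>1 / h\<close>, hence the factor \<open>[:0,1:]\<close>; left of 0 it is identically
      0.\<close>
    have "((\<lambda>s. poly ([:0,1:] * q) s * exp (- s)) \<longlongrightarrow> (0::real)) at_top"
      by (rule poly_exp_tendsto_0)
    then have "((\<lambda>h. poly ([:0,1:] * q) (inverse h) * exp (- inverse h)) \<longlongrightarrow> (0::real)) (at_right 0)"
      using filterlim_inverse_at_top_right filterlim_compose by blast
    then have "((\<lambda>h. (flat q (0 + h) - flat q 0) / h) \<longlongrightarrow> 0) (at_right 0)"
      by (rule Lim_transform_eventually)
        (auto simp: flat_def eventually_at_filter field_simps)
    moreover have "((\<lambda>h. (flat q (0 + h) - flat q 0) / h) \<longlongrightarrow> 0) (at_left 0)"
      by (rule Lim_transform_eventually[OF tendsto_const])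
        (auto simp: flat_def eventually_at_filter)
    ultimately have "((\<lambda>h. (flat q (0 + h) - flat q 0) / h) \<longlongrightarrow> 0) (at 0)"
      using filterlim_split_at by blast
    then show ?thesis using 3 by (simp add: DERIV_def flat_def)
  qed
qed

lemma times_differentiable_flat: "times_differentiable n (flat q)"
proof (induction n arbitrary: q)
  case 0
  then show ?case
    using flat_DERIV real_differentiable_def
    unfolding times_differentiable.simps differentiable_on_def by blast
next
  case (Suc n)
  then show ?case using flat_DERIV times_differentiable_SucI by blast
qed

text \<open>As \<open>n \<rightarrow> \<infinity>\<close> these bumps tend to the indicator function of \<open>(c,d)\<close>.\<close>

definition bump :: "real \<Rightarrow> real \<Rightarrow> nat \<Rightarrow> real \<Rightarrow> real" where
  "bump c d n t = flat 1 (real (Suc n) * (t - c)) * flat 1 (real (Suc n) * (d - t))"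

lemma times_differentiable_bump: "times_differentiable k (bump c d n)"
proof -
  have "bump c d n = (\<lambda>t. flat 1 (real (Suc n) * t + (- real (Suc n) * c)) * flat 1 ((- real (Suc n)) * t + real (Suc n) * d))"
    by (auto simp: bump_def fun_eq_iff algebra_simps)
  then show ?thesis
    by (simp only:) (intro times_differentiable_mult times_differentiable_affine times_differentiable_flat)
qed

lemma bump_eq_0: "t \<le> c \<or> d \<le> t \<Longrightarrow> bump c d n t = 0"
  by (auto simp: bump_def flat_def zero_less_mult_iff)

lemma bump_nonneg: "0 \<le> bump c d n t"
  by (auto simp: bump_def flat_def)

lemma bump_le_1: "bump c d n t \<le> 1"
  by (auto simp: bump_def flat_def intro!: mult_le_one)

lemma bump_tendsto:
  assumes "c < t" "t < d" shows "(\<lambda>n. bump c d n t) \<longlonglongrightarrow> 1"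
proof -
  have *: "(\<lambda>n. flat 1 (real (Suc n) * s)) \<longlonglongrightarrow> 1" if "s > 0" for s
  proof -
    have "(\<lambda>n. exp (- (inverse s * inverse (real (Suc n))))) \<longlonglongrightarrow> exp (- (inverse s * 0))"
      by (intro tendsto_intros LIMSEQ_inverse_real_of_nat)
    moreover have "flat 1 (real (Suc n) * s) = exp (- (inverse s * inverse (real (Suc n))))" for n
      using that by (simp add: flat_def divide_inverse mult_ac del: of_nat_Suc)
    ultimately show ?thesis by simp
  qed
  have "(\<lambda>n. bump c d n t) \<longlonglongrightarrow> 1 * 1"
    unfolding bump_def using assms by (intro tendsto_mult *) auto
  then show ?thesis by simp
qed

lemma continuous_on_bump: "continuous_on S (bump c d n)"
  using times_differentiable_bump[of 0 c d n] differentiable_imp_continuous_on continuous_on_subset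
  by (metis subset_UNIV times_differentiable.simps(1))

text \<open>Zero mean forces the primitive back to 0 at \<open>d\<close>, so its support stays in
  \<open>[c,d]\<close>, inside \<open>(a,b)\<close>. Test functions can thus be prescribed through
  their derivatives.\<close>

lemma test_function_antiderivative:
  fixes \<theta> :: "real \<Rightarrow> real"
  assumes smooth: "\<And>n. times_differentiable n \<theta>"
    and supp: "\<And>t. t \<le> c \<or> d \<le> t \<Longrightarrow> \<theta> t = 0"
    and I0: "integral {c..d} \<theta> = 0" and "a < c" "c < d" "d < b"
  obtains \<psi> where "test_function a b \<psi>" "deriv \<psi> = \<theta>"
proof -
  have cont: "continuous_on S \<theta>" for S
    using smooth[of 0] differentiable_imp_continuous_on continuous_on_subset
    by (metis subset_UNIV times_differentiable.simps(1))
  \<comment> \<open>Starting at \<open>c - 1\<close> rather than at \<open>c\<close> makes the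
    ranges \<open>t > c - 1\<close> and \<open>t < c\<close>, on which the derivative is found
    separately, overlap. For \<open>t < c - 1\<close> the interval is empty and the integral is
    0.\<close>
  define \<psi> where "\<psi> t = integral {c - 1..t} \<theta>" for t
  have z: "integral {u..v} \<theta> = 0" if "v \<le> c \<or> d \<le> u" for u v
    using integral_cong[of "{u..v}" \<theta> "\<lambda>_. 0"] supp that by force
  have D1: "(\<psi> has_field_derivative \<theta> t) (at t)" if "t > c - 1" for t
  proof -
    have "(\<psi> has_real_derivative \<theta> t) (at t within {c - 1..t+1})"
      unfolding \<psi>_def using that by (intro integral_has_real_derivative cont) auto
    then show ?thesis using that at_within_interior[of t "{c-1..t+1}"] by simp
  qed
  have D2: "(\<psi> has_field_derivative \<theta> t) (at t)" if "t < c" for t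
  proof -
    have "((\<lambda>_. 0) has_field_derivative \<theta> t) (at t)" using supp that by simp
    then show ?thesis
      by (rule has_field_derivative_transform_within_open[where S="{..<c}"])
        (use that z in \<open>auto simp: \<psi>_def\<close>)
  qed
  have D: "(\<psi> has_field_derivative \<theta> t) (at t)" for t
    using D1 D2 by (cases "t < c") auto
  have d: "deriv \<psi> = \<theta>" using D DERIV_imp_deriv by blast
  have "\<psi> t = 0" if "t < c \<or> d < t" for t
  proof (cases "t < c")
    case False
    then have "d < t" using that by auto
    have "integral {c-1..d} \<theta> + integral {d..t} \<theta> = \<psi> t"
      unfolding \<psi>_def using \<open>d < t\<close> \<open>c < d\<close> cont
      by (intro Henstock_Kurzweil_Integration.integral_combine integrable_continuous_real) auto
    moreover have "integral {c-1..c} \<theta> + integral {c..d} \<theta> = integral {c-1..d} \<theta>"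
      using \<open>c < d\<close> cont
      by (intro Henstock_Kurzweil_Integration.integral_combine integrable_continuous_real) auto
    ultimately show ?thesis using z[of c "c-1"] z[of t d] I0 by simp
  qed (use z in \<open>auto simp: \<psi>_def\<close>)
  then have "{t. \<psi> t \<noteq> 0} \<subseteq> {c..d}" by force
  then have cl: "closure {t. \<psi> t \<noteq> 0} \<subseteq> {c..d}" by (simp add: closure_minimal)
  have "test_function a b \<psi>"
    unfolding test_function_def
  proof (intro conjI allI)
    show "(deriv ^^ n) \<psi> differentiable_on UNIV" for n
      using times_differentiable_imp_deriv_funpow times_differentiable_SucI[OF D smooth]
        times_differentiable_Suc_imp by blast
    show "compact (closure {t. \<psi> t \<noteq> 0})"
      using cl by (meson bounded_closed_interval bounded_subset closed_closure compact_eq_bounded_closed)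
    show "closure {t. \<psi> t \<noteq> 0} \<subseteq> {a<..<b}" using cl assms by force
  qed
  then show ?thesis using that d by blast
qed

subsection \<open>Weak derivatives\<close>

lemma test_function_DERIV:
  assumes "test_function a b \<psi>"
  shows "(\<psi> has_field_derivative deriv \<psi> t) (at t)"
  using assms unfolding test_function_def differentiable_on_def
  by (metis DERIV_deriv_iff_real_differentiable UNIV_I funpow_0)

lemma continuous_on_deriv_test_function:
  assumes "test_function a b \<psi>"
  shows "continuous_on S (deriv \<psi>)"
proof -
  have "(deriv ^^ 1) \<psi> differentiable_on UNIV"
    using assms unfolding test_function_def by blast
  then show ?thesis
    using differentiable_imp_continuous_on continuous_on_subset by fastforce
qed

lemma test_function_eq_0:
  assumes "test_function a b \<psi>" "t \<le> a \<or> b \<le> t"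
  shows "\<psi> t = 0"
proof (rule ccontr)
  assume "\<psi> t \<noteq> 0"
  then have "t \<in> closure {t. \<psi> t \<noteq> 0}" using closure_subset by fast
  then have "t \<in> {a<..<b}" using assms(1) unfolding test_function_def by blast
  then show False using assms(2) by auto
qed

lemma integrable_lebesgue_on_bounded_mult:
  fixes f g :: "real \<Rightarrow> real"
  assumes f: "integrable (lebesgue_on S) f" and g: "g \<in> borel_measurable (lebesgue_on S)"
    and "\<And>t. t \<in> S \<Longrightarrow> \<bar>g t\<bar> \<le> C" and S: "S \<in> sets lebesgue"
  shows "integrable (lebesgue_on S) (\<lambda>t. f t * g t)"
proof (rule Bochner_Integration.integrable_bound)
  show "integrable (lebesgue_on S) (\<lambda>t. C * f t)" using f by simp
  show "(\<lambda>t. f t * g t) \<in> borel_measurable (lebesgue_on S)"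
    using f g by auto
  show "AE t in lebesgue_on S. norm (f t * g t) \<le> norm (C * f t)"
  proof (intro AE_I2)
    fix t assume "t \<in> space (lebesgue_on S)"
    then have "\<bar>g t\<bar> \<le> \<bar>C\<bar>" using assms(3)[of t] by simp
    then show "norm (f t * g t) \<le> norm (C * f t)"
      by (simp add: abs_mult mult.commute[of "\<bar>C\<bar>"] mult_left_mono)
  qed
qed

lemma integrable_lebesgue_on_mult_continuous:
  fixes f g :: "real \<Rightarrow> real"
  assumes f: "integrable (lebesgue_on {a<..<b}) f" and g: "continuous_on {a..b} g"
  shows "integrable (lebesgue_on {a<..<b}) (\<lambda>t. f t * g t)"
proof -
  obtain C where "\<And>t. t \<in> {a..b} \<Longrightarrow> \<bar>g t\<bar> \<le> C"
    using compact_imp_bounded[OF compact_continuous_image[OF g]] by (force simp: bounded_iff)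
  moreover have "g \<in> borel_measurable (lebesgue_on {a<..<b})"
    by (rule continuous_imp_measurable_on_sets_lebesgue[OF continuous_on_subset[OF g]]) auto
  ultimately show ?thesis
    using f by (intro integrable_lebesgue_on_bounded_mult[where C=C]) auto
qed

text \<open>The lemma of du Bois-Reymond. Zero-mean combinations of two bumps are derivatives of
  test functions; in the limit they show that integrals of \<open>h\<close> over intervals are
  proportional to the length. Lebesgue differentiation then yields the constant.\<close>

lemma weak_derivative_0_imp_AE_const:
  fixes h :: "real \<Rightarrow> real"
  assumes "a < b" and h: "integrable (lebesgue_on {a<..<b}) h"
    and weak: "\<And>\<psi>. test_function a b \<psi> \<Longrightarrow> (LINT t|lebesgue_on {a<..<b}. h t * deriv \<psi> t) = 0"
  obtains K where "AE t in lebesgue_on {a<..<b}. h t = K"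
proof -
  let ?S = "{a<..<b}"
  have hI: "h integrable_on ?S"
    using h by (simp add: integrable_on_lebesgue_on)
  have hsub: "h integrable_on {c..d}" if "a < c" "d < b" for c d
    using integrable_on_subinterval[OF hI, of c d] that by force
  have hb: "integrable (lebesgue_on ?S) (\<lambda>t. h t * bump c d n t)" for c d n
    by (intro integrable_lebesgue_on_mult_continuous h continuous_on_bump)
  have lim: "(\<lambda>n. LINT t|lebesgue_on ?S. h t * bump c d n t) \<longlonglongrightarrow> integral {c..d} h"
    if "a < c" "c < d" "d < b" for c d
  proof -
    let ?g = "\<lambda>t. if t \<in> {c<..<d} then h t else 0"
    have "(\<lambda>n. integral ?S (\<lambda>t. h t * bump c d n t)) \<longlonglongrightarrow> integral ?S ?g"
    proof (rule dominated_convergence)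
      show "(\<lambda>t. h t * bump c d n t) integrable_on ?S" for n
        using hb by (simp add: integrable_on_lebesgue_on)
      show "(\<lambda>t. norm (h t)) integrable_on ?S"
        using integrable_on_lebesgue_on[OF integrable_norm[OF h]] by simp
      show "norm (h t * bump c d n t) \<le> norm (h t)" for n t
        using bump_nonneg[of c d n t] bump_le_1[of c d n t]
        by (simp add: abs_mult mult_left_le)
      show "(\<lambda>n. h t * bump c d n t) \<longlonglongrightarrow> ?g t" for t
      proof (cases "t \<in> {c<..<d}")
        case True
        then show ?thesis using tendsto_mult[OF tendsto_const bump_tendsto[of c t d]] by simp
      next
        case False
        then show ?thesis using bump_eq_0[of t c d] by auto
      qed
    qed
    moreover have "integral ?S ?g = integral {c<..<d} h"
    proof -
      have "{c<..<d} \<inter> ?S = {c<..<d}" using that by auto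
      then show ?thesis using integral_restrict_Int[of ?S "{c<..<d}" h] by simp
    qed
    moreover have "integral {c<..<d} h = integral {c..d} h"
      using integral_open_interval[of c d h] by simp
    ultimately show ?thesis
      using hb by (simp add: lebesgue_integral_eq_integral)
  qed
  have limJ: "(\<lambda>n. integral {u..v} (bump c d n)) \<longlonglongrightarrow> d - c"
    if "u \<le> c" "c < d" "d \<le> v" for c d u v
  proof -
    let ?g = "\<lambda>t. if t \<in> {c<..<d} then 1 else (0::real)"
    have "(\<lambda>n. integral {u..v} (bump c d n)) \<longlonglongrightarrow> integral {u..v} ?g"
    proof (rule dominated_convergence)
      show "bump c d n integrable_on {u..v}" for n
        by (intro integrable_continuous_real continuous_on_bump)
      show "(\<lambda>t. 1::real) integrable_on {u..v}" by (rule integrable_const_ivl)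
      show "norm (bump c d n t) \<le> 1" for n t
        using bump_nonneg[of c d n t] bump_le_1[of c d n t] by simp
      show "(\<lambda>n. bump c d n t) \<longlonglongrightarrow> ?g t" for t
        using bump_tendsto[of c t d] bump_eq_0[of t c d] by (cases "t \<in> {c<..<d}") auto
    qed
    moreover have "integral {u..v} ?g = integral {c<..<d} (\<lambda>_. 1)"
    proof -
      have "{u..v} \<inter> {c<..<d} = {c<..<d}" "{c<..<d} \<inter> {u..v} = {c<..<d}" using that by auto
      then show ?thesis using integral_restrict_Int[of "{u..v}" "{c<..<d}" "\<lambda>_. 1::real"] by simp
    qed
    moreover have "integral {c<..<d} (\<lambda>_. 1::real) = integral {c..d} (\<lambda>_. 1)"
      using integral_open_interval[of c d "\<lambda>_. 1::real"] by simp
    ultimately show ?thesis using that by simp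
  qed
  \<comment> \<open>The middle third of \<open>(a,b)\<close> serves as the reference interval with
    which all others are compared.\<close>
  define c0 d0 where "c0 = (2*a+b)/3" and "d0 = (a+2*b)/3"
  have cd0: "a < c0" "c0 < d0" "d0 < b" using \<open>a < b\<close> by (auto simp: c0_def d0_def)
  have proportional: "(d0 - c0) * integral {c..d} h = (d - c) * integral {c0..d0} h"
    if cd: "a < c" "c < d" "d < b" for c d
  proof -
    define u v where "u = min c c0" and "v = max d d0"
    have uv: "a < u" "u < v" "v < b" "u \<le> c" "d \<le> v" "u \<le> c0" "d0 \<le> v"
      using cd cd0 by (auto simp: u_def v_def)
    define I J where "I n = integral {u..v} (bump c0 d0 n)" and "J n = integral {u..v} (bump c d n)" for n
    have eq: "I n * (LINT t|lebesgue_on ?S. h t * bump c d n t)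
        = J n * (LINT t|lebesgue_on ?S. h t * bump c0 d0 n t)" for n
    proof -
      \<comment> \<open>Each bump is weighted with the mass of the other, so the two contributions
        to the mean cancel exactly for every \<open>n\<close>.\<close>
      define \<theta> where "\<theta> t = I n * bump c d n t + (- J n) * bump c0 d0 n t" for t
      have "integral {u..v} \<theta> = I n * J n + (- J n) * I n"
        unfolding \<theta>_def I_def J_def
        by (subst Henstock_Kurzweil_Integration.integral_add)
          (auto intro!: integrable_continuous_real continuous_intros continuous_on_bump)
      then have "integral {u..v} \<theta> = 0" by simp
      moreover have "times_differentiable k \<theta>" for k
        unfolding \<theta>_def
        by (intro times_differentiable_add times_differentiable_mult times_differentiable_const times_differentiable_bump)
      moreover have "\<theta> t = 0" if "t \<le> u \<or> v \<le> t" for t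
        using that uv unfolding \<theta>_def by (subst (1 2) bump_eq_0) auto
      ultimately obtain \<psi> where "test_function a b \<psi>" "deriv \<psi> = \<theta>"
        using test_function_antiderivative[of \<theta> u v a b] uv by auto
      then have "0 = (LINT t|lebesgue_on ?S. h t * \<theta> t)" using weak[of \<psi>] by simp
      also have "\<dots> = (LINT t|lebesgue_on ?S. I n * (h t * bump c d n t) - J n * (h t * bump c0 d0 n t))"
        by (rule Bochner_Integration.integral_cong) (auto simp: \<theta>_def algebra_simps)
      also have "\<dots> = I n * (LINT t|lebesgue_on ?S. h t * bump c d n t)
        - J n * (LINT t|lebesgue_on ?S. h t * bump c0 d0 n t)"
        using hb by (subst Bochner_Integration.integral_diff) auto
      finally show ?thesis by simp
    qed
    have "(\<lambda>n. I n * (LINT t|lebesgue_on ?S. h t * bump c d n t)) \<longlonglongrightarrow> (d0 - c0) * integral {c..d} h"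
      unfolding I_def using cd cd0 uv by (intro tendsto_mult lim limJ) auto
    moreover have "(\<lambda>n. J n * (LINT t|lebesgue_on ?S. h t * bump c0 d0 n t)) \<longlonglongrightarrow> (d - c) * integral {c0..d0} h"
      unfolding J_def using cd cd0 uv by (intro tendsto_mult lim limJ) auto
    ultimately show ?thesis unfolding eq using LIMSEQ_unique by blast
  qed
  define K where "K = integral {c0..d0} h / (d0 - c0)"
  \<comment> \<open>Extension by 0 makes \<open>f\<close> integrable on every interval, as the
    differentiation theorem demands.\<close>
  define f where "f t = (if t \<in> ?S then h t - K else 0)" for t
  have "f integrable_on UNIV"
    unfolding f_def integrable_restrict_UNIV
    by (intro Henstock_Kurzweil_Integration.integrable_diff hI integrable_on_const) simp
  then have "f integrable_on cbox u v" for u v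
    using integrable_on_subcbox subset_UNIV by blast
  \<comment> \<open>Lebesgue's differentiation theorem: off a null set, the averages of
    \<open>f\<close> over \<open>[x,x+h]\<close> tend to \<open>f x\<close>.\<close>
  then obtain N where N: "negligible N" "\<And>x e. \<lbrakk>x \<notin> N; 0 < e\<rbrakk> \<Longrightarrow>
     \<exists>d>0. \<forall>h. 0 < h \<and> h < d \<longrightarrow> norm (integral (cbox x (x + h *\<^sub>R One)) f /\<^sub>R h ^ DIM(real) - f x) < e"
    by (rule integrable_ccontinuous_explicit[of f]) (rule that)
  have "h t = K" if "t \<in> ?S - N" for t
  proof (rule ccontr)
    assume "h t \<noteq> K"
    then have "0 < norm (h t - K)" by simp
    moreover have "t \<notin> N" using that by simp
    ultimately have "\<exists>d>0. \<forall>h'. 0 < h' \<and> h' < d \<longrightarrow>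
       norm (integral (cbox t (t + h' *\<^sub>R One)) f /\<^sub>R h' ^ DIM(real) - f t) < norm (h t - K)"
      by (intro N(2))
    then obtain d where d: "d > 0" "\<forall>h'. 0 < h' \<and> h' < d \<longrightarrow>
       norm (integral (cbox t (t + h' *\<^sub>R One)) f /\<^sub>R h' ^ DIM(real) - f t) < norm (h t - K)"
      by (elim exE conjE)
    \<comment> \<open>Small enough for the differentiation estimate and for \<open>[t,t+r]\<close>
      to stay in \<open>(a,b)\<close>. There the average of \<open>f\<close> is 0 by
      \<open>proportional\<close>, which contradicts \<open>f t = h t - K\<close> being
      nonzero.\<close>
    define r where "r = min d (b - t) / 2"
    have r: "0 < r" "r < d" "a < t" "t < t + r" "t + r < b"
      using d(1) that by (auto simp: r_def min_def field_simps)
    have "integral {t..t+r} f = integral {t..t+r} (\<lambda>s. h s - K)"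
      using r by (intro integral_cong) (auto simp: f_def)
    also have "\<dots> = integral {t..t+r} h - K * r"
      using r hsub[of t "t+r"] by (subst Henstock_Kurzweil_Integration.integral_diff) auto
    also have "\<dots> = 0"
      using proportional[of t "t+r"] r cd0 by (auto simp: K_def field_simps)
    finally show False using d(2)[THEN spec, of r] r that by (simp add: f_def)
  qed
  then have "{t \<in> ?S. h t \<noteq> K} \<subseteq> N" by blast
  then have "negligible {t \<in> ?S. h t \<noteq> K}" using N(1) negligible_subset by blast
  then have "AE t in lebesgue. t \<in> ?S \<longrightarrow> h t = K"
    using eventually_ae_filter_negligible[of "\<lambda>t. t \<in> ?S \<longrightarrow> h t = K"] by auto
  then have "AE t in lebesgue_on ?S. h t = K"
    by (simp add: AE_restrict_space_iff)
  then show ?thesis using that by blast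
qed

text \<open>Since \<open>f\<close> is only integrable, its primitive need not be differentiable
  everywhere. Fubini's theorem on the region \<open>s \<le> t\<close> replaces the product rule: the
  inner integral of \<open>deriv \<psi>\<close> over \<open>[s,b]\<close> is
  \<open>- \<psi> s\<close>. The constant \<open>C\<close> drops out because
  \<open>deriv \<psi>\<close> has mean 0.\<close>

lemma integral_primitive_mult_deriv_test_function:
  fixes f :: "real \<Rightarrow> real"
  assumes "a < b" and f: "integrable (lebesgue_on {a<..<b}) f" and \<psi>: "test_function a b \<psi>"
  shows "(LINT t|lebesgue_on {a<..<b}. (C + integral {a..t} f) * deriv \<psi> t)
     = - (LINT t|lebesgue_on {a<..<b}. f t * \<psi> t)"
proof -
  let ?S = "{a<..<b}"
  have fS: "integrable lebesgue (\<lambda>t. indicator ?S t * f t)"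
    using f integrable_restrict_space[of ?S lebesgue f] by simp
  \<comment> \<open>Fubini's theorem is applied to \<open>lborel\<close>, so the zero extension of
    \<open>f\<close> is replaced by a Borel function equal to it almost everywhere.\<close>
  then obtain f0 where f0m [measurable]: "f0 \<in> borel_measurable lborel"
    and f0: "AE t in lborel. indicator ?S t * f t = f0 t"
    using completion_ex_borel_measurable_real[of "\<lambda>t. indicator ?S t * f t" lborel]
      borel_measurable_integrable by blast
  have f0C: "AE t in lebesgue. indicator ?S t * f t = f0 t"
    using f0 by (rule AE_completion)
  have "integrable lebesgue f0"
    using fS f0C f0m by (subst integrable_cong_AE[symmetric]) (auto intro: measurable_completion borel_measurable_integrable[OF fS])
  then have f0i: "integrable lborel f0"
    by (simp add: integrable_completion)
  have int_eq: "(LINT t|lebesgue_on ?S. f t * \<eta> t) = (LINT t|lborel. f0 t * \<eta> t)"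
    if \<eta> [measurable]: "\<eta> \<in> borel_measurable borel" for \<eta>
  proof -
    have \<eta>': "\<eta> \<in> borel_measurable lebesgue"
      using \<eta> by (simp add: measurable_completion)
    have "(LINT t|lebesgue_on ?S. f t * \<eta> t) = (LINT t|lebesgue. (indicator ?S t * f t) * \<eta> t)"
      by (simp add: integral_restrict_space mult.assoc)
    also have "\<dots> = (LINT t|lebesgue. f0 t * \<eta> t)"
    proof (rule integral_cong_AE)
      show "(\<lambda>t. indicator ?S t * f t * \<eta> t) \<in> borel_measurable lebesgue"
        using borel_measurable_integrable[OF fS] \<eta>' by (rule borel_measurable_times)
      show "(\<lambda>t. f0 t * \<eta> t) \<in> borel_measurable lebesgue"
        by (rule measurable_completion) measurable
      show "AE t in lebesgue. indicator ?S t * f t * \<eta> t = f0 t * \<eta> t"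
        using f0C by eventually_elim simp
    qed
    also have "\<dots> = (LINT t|lborel. f0 t * \<eta> t)"
      by (rule integral_completion) measurable
    finally show ?thesis .
  qed
  \<comment> \<open>Written over the whole line with an indicator, the primitive fits into a double
    integral; on \<open>(a,b)\<close> it agrees with \<open>integral {a..t} f\<close>.\<close>
  define G where "G t = (LINT s|lborel. f0 s * indicator {..t} s)" for t
  have G: "integral {a..t} f = G t" if "t \<in> ?S" for t
  proof -
    have 1: "integrable (lebesgue_on ?S) (\<lambda>s. f s * indicator {..t} s)"
    proof (rule integrable_lebesgue_on_bounded_mult[OF f])
      have "(\<lambda>s. indicator {..t} s :: real) \<in> borel_measurable lebesgue"
        by (rule measurable_completion) simp
      then show "(\<lambda>s. indicator {..t} s :: real) \<in> borel_measurable (lebesgue_on ?S)"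
        by (rule measurable_restrict_space1)
      show "\<bar>indicator {..t} s :: real\<bar> \<le> 1" for s by (simp add: indicator_def)
    qed simp
    have "G t = (LINT s|lebesgue_on ?S. f s * indicator {..t} s)"
      unfolding G_def by (rule int_eq[symmetric]) simp
    also have "\<dots> = integral ?S (\<lambda>s. f s * indicator {..t} s)"
      using 1 by (simp add: lebesgue_integral_eq_integral)
    also have "\<dots> = integral ?S (\<lambda>s. if s \<in> {..t} then f s else 0)"
      by (rule integral_cong) (simp add: indicator_def)
    also have "\<dots> = integral ({..t} \<inter> ?S) f"
      by (rule integral_restrict_Int)
    also have "\<dots> = integral {a..t} f"
    proof (rule integral_spike_set)
      show "negligible {s \<in> {..t} \<inter> ?S - {a..t}. f s \<noteq> 0}"
        by (rule negligible_subset[of "{}"]) auto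
      show "negligible {s \<in> {a..t} - {..t} \<inter> ?S. f s \<noteq> 0}"
        by (rule negligible_subset[of "{a}"]) (use that in auto)
    qed
    finally show ?thesis by simp
  qed
  define D where "D = deriv \<psi>"
  have contD: "continuous_on A D" for A
    unfolding D_def by (rule continuous_on_deriv_test_function[OF \<psi>])
  have [measurable]: "D \<in> borel_measurable borel"
    by (rule borel_measurable_continuous_onI[OF contD])
  have cont\<psi>: "continuous_on A \<psi>" for A
    using test_function_DERIV[OF \<psi>] DERIV_isCont continuous_at_imp_continuous_on by blast
  have [measurable]: "\<psi> \<in> borel_measurable borel"
    by (rule borel_measurable_continuous_onI[OF cont\<psi>])
  \<comment> \<open>A point outside \<open>(a,b)\<close> lies in the open complement of the closed
    support, where \<open>\<psi>\<close> is locally 0. Integrals against \<open>D\<close> may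
    therefore run over the whole line.\<close>
  have D0: "D t = 0" if "t \<notin> ?S" for t
  proof -
    let ?O = "- closure {t. \<psi> t \<noteq> 0}"
    have t: "t \<in> ?O" using \<psi> that unfolding test_function_def by blast
    have z: "\<psi> s = 0" if "s \<in> ?O" for s
      using that closure_subset[of "{t. \<psi> t \<noteq> 0}"] by auto
    have "(\<psi> has_field_derivative 0) (at t)"
      by (rule has_field_derivative_transform_within_open[OF DERIV_const[of 0] open_Compl[OF closed_closure] t])
        (rule z[symmetric])
    then show ?thesis unfolding D_def by (rule DERIV_imp_deriv)
  qed
  have D_FTC: "(LINT t|lborel. indicator {s..b} t *\<^sub>R D t) = - \<psi> s" if "s \<le> b" for s
  proof -
    have "(LINT t|lborel. indicator {s..b} t *\<^sub>R D t) = \<psi> b - \<psi> s"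
      using that test_function_DERIV[OF \<psi>] contD
      by (intro integral_FTC_atLeastAtMost)
        (auto simp: D_def has_real_derivative_iff_has_vector_derivative[symmetric] intro: DERIV_subset)
    then show ?thesis using test_function_eq_0[OF \<psi>] by simp
  qed
  have Dint: "integrable lborel D"
  proof -
    have "integrable lborel (\<lambda>t. indicator {a..b} t *\<^sub>R D t)"
      using borel_integrable_atLeastAtMost'[OF contD, of a b] unfolding set_integrable_def .
    moreover have "indicator {a..b} t *\<^sub>R D t = D t" for t
      using D0[of t] by (cases "t \<in> ?S") auto
    ultimately show ?thesis by (simp only:)
  qed
  have restrict: "(LINT t|lebesgue_on ?S. \<eta> t * D t) = (LINT t|lborel. \<eta> t * D t)"
    if [measurable]: "\<eta> \<in> borel_measurable borel" for \<eta>
  proof -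
    have "(LINT t|lebesgue_on ?S. \<eta> t * D t) = (LINT t|lebesgue. indicator ?S t *\<^sub>R (\<eta> t * D t))"
      by (simp add: integral_restrict_space)
    also have "indicator ?S t *\<^sub>R (\<eta> t * D t) = \<eta> t * D t" for t
      using D0[of t] by (cases "t \<in> ?S") auto
    then have "(LINT t|lebesgue. indicator ?S t *\<^sub>R (\<eta> t * D t)) = (LINT t|lebesgue. \<eta> t * D t)"
      by (simp only:)
    also have "(LINT t|lebesgue. \<eta> t * D t) = (LINT t|lborel. \<eta> t * D t)"
      by (rule integral_completion) measurable
    finally show ?thesis .
  qed
  \<comment> \<open>A product of integrable functions of separate variables; it dominates the
    integrand cut off to \<open>s \<le> t\<close>.\<close>
  have prod_int: "integrable (lborel \<Otimes>\<^sub>M lborel) (\<lambda>(s, t). f0 s * D t)"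
  proof (rule lborel_pair.Fubini_integrable)
    show "integrable lborel (\<lambda>s. LINT t|lborel. norm (case (s, t) of (s, t) \<Rightarrow> f0 s * D t))"
      using f0i by (simp add: abs_mult)
    show "AE s in lborel. integrable lborel (\<lambda>t. case (s, t) of (s, t) \<Rightarrow> f0 s * D t)"
      using Dint by simp
  qed measurable
  have prod_int': "integrable (lborel \<Otimes>\<^sub>M lborel) (\<lambda>(s, t). f0 s * indicator {..t} s * D t)"
  proof (rule Bochner_Integration.integrable_bound[OF prod_int])
    have "(\<lambda>(s, t). f0 s * (if s \<le> t then 1 else 0) * D t) \<in> borel_measurable (lborel \<Otimes>\<^sub>M lborel)"
      by measurable
    then show "(\<lambda>(s, t). f0 s * indicator {..t} s * D t) \<in> borel_measurable (lborel \<Otimes>\<^sub>M lborel)"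
      by (simp add: indicator_def of_bool_def)
    show "AE z in lborel \<Otimes>\<^sub>M lborel. norm (case z of (s, t) \<Rightarrow> f0 s * indicator {..t} s * D t)
        \<le> norm (case z of (s, t) \<Rightarrow> f0 s * D t)"
      by (auto simp: indicator_def)
  qed
  have Gm [measurable]: "G \<in> borel_measurable borel"
  proof -
    have "(\<lambda>t. LINT s|lborel. f0 s * (if s \<le> t then 1 else 0)) \<in> borel_measurable borel"
      by measurable
    then show ?thesis unfolding G_def by (simp add: indicator_def of_bool_def)
  qed
  have GD: "integrable lborel (\<lambda>t. G t * D t)"
    using lborel_pair.integrable_snd[OF prod_int'] unfolding G_def by simp
  \<comment> \<open>\<open>D_FTC\<close> covers \<open>s \<le> b\<close> only; beyond
    \<open>b\<close> the factor \<open>f0 s\<close> vanishes almost everywhere.\<close>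
  have f0neg: "AE s in lborel. \<not> s \<le> b \<longrightarrow> f0 s = 0"
    using f0 by eventually_elim (auto simp: indicator_def)
  have "(LINT t|lborel. G t * D t) = (LINT t|lborel. LINT s|lborel. f0 s * indicator {..t} s * D t)"
    unfolding G_def by simp
  also have "\<dots> = (LINT s|lborel. LINT t|lborel. f0 s * indicator {..t} s * D t)"
    by (rule lborel_pair.Fubini_integral[OF prod_int'])
  also have "\<dots> = (LINT s|lborel. f0 s * (LINT t|lborel. indicator {s..b} t *\<^sub>R D t))"
  proof -
    have "(LINT t|lborel. f0 s * indicator {..t} s * D t) = f0 s * (LINT t|lborel. indicator {s..b} t *\<^sub>R D t)" for s
    proof -
      have "f0 s * indicator {..t} s * D t = f0 s * (indicator {s..b} t *\<^sub>R D t)" for t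
        using D0[of t] by (cases "t \<in> ?S") (auto simp: indicator_def)
      then have "(LINT t|lborel. f0 s * indicator {..t} s * D t) = (LINT t|lborel. f0 s * (indicator {s..b} t *\<^sub>R D t))"
        by (simp only:)
      then show ?thesis by simp
    qed
    then show ?thesis by simp
  qed
  also have "\<dots> = (LINT s|lborel. - (f0 s * \<psi> s))"
  proof (rule integral_cong_AE)
    have "(\<lambda>s. f0 s * (LINT t|lborel. (if s \<le> t \<and> t \<le> b then 1 else 0) *\<^sub>R D t)) \<in> borel_measurable lborel"
      by measurable
    then show "(\<lambda>s. f0 s * (LINT t|lborel. indicator {s..b} t *\<^sub>R D t)) \<in> borel_measurable lborel"
      by (simp add: indicator_def of_bool_def)
    show "AE s in lborel. f0 s * (LINT t|lborel. indicator {s..b} t *\<^sub>R D t) = - (f0 s * \<psi> s)"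
      using f0neg by eventually_elim (use D_FTC in auto)
  qed measurable
  also have "\<dots> = - (LINT t|lebesgue_on ?S. f t * \<psi> t)"
    by (simp add: int_eq)
  finally have main: "(LINT t|lborel. G t * D t) = - (LINT t|lebesgue_on ?S. f t * \<psi> t)" .
  have "(LINT t|lborel. D t) = (LINT t|lborel. indicator {a..b} t *\<^sub>R D t)"
  proof (rule Bochner_Integration.integral_cong)
    show "D t = indicator {a..b} t *\<^sub>R D t" for t
      using D0[of t] by (cases "t \<in> ?S") auto
  qed simp
  then have D_zero: "(LINT t|lborel. D t) = 0"
    using D_FTC[of a] \<open>a < b\<close> test_function_eq_0[OF \<psi>] by simp
  have "(LINT t|lebesgue_on ?S. (C + integral {a..t} f) * deriv \<psi> t)
      = (LINT t|lebesgue_on ?S. (C + G t) * D t)"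
    using G by (intro Bochner_Integration.integral_cong) (auto simp: D_def)
  also have "\<dots> = (LINT t|lborel. (C + G t) * D t)"
    by (rule restrict) measurable
  also have "\<dots> = (LINT t|lborel. C * D t + G t * D t)"
    by (simp add: distrib_right)
  also have "\<dots> = C * (LINT t|lborel. D t) + (LINT t|lborel. G t * D t)"
    using Dint GD by simp
  finally show ?thesis using D_zero main by simp
qed

subsection \<open>Lebesgue and Sobolev spaces\<close>

lemma integrable_lebesgue_on_const [simp]:
  "integrable (lebesgue_on {a<..<b::real}) (\<lambda>t. c::real)"
  by (intro absolutely_integrable_imp_integrable absolutely_integrable_on_const) auto

text \<open>On the whole line integrands can be translated and cut off freely; the zero extension
  transfers these operations to an interval.\<close>

lemma Lp_iff_zero_extension:
  "f \<in> Lp p a b \<longleftrightarrow> (\<lambda>t. if t \<in> {a<..<b} then f t else 0) \<in> borel_measurable lebesgue \<and>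
     integrable lebesgue (\<lambda>t. \<bar>if t \<in> {a<..<b} then f t else 0\<bar> powr p)"
proof -
  have "indicator {a<..<b} t *\<^sub>R \<bar>f t\<bar> powr p = \<bar>if t \<in> {a<..<b} then f t else 0\<bar> powr p" for t by simp
  then have "integrable (lebesgue_on {a<..<b}) (\<lambda>t. \<bar>f t\<bar> powr p) \<longleftrightarrow>
      integrable lebesgue (\<lambda>t. \<bar>if t \<in> {a<..<b} then f t else 0\<bar> powr p)"
    using integrable_restrict_space[of "{a<..<b}" lebesgue "\<lambda>t. \<bar>f t\<bar> powr p"] by (simp only:) simp
  moreover have "f \<in> borel_measurable (lebesgue_on {a<..<b}) \<longleftrightarrow>
      (\<lambda>t. if t \<in> {a<..<b} then f t else 0) \<in> borel_measurable lebesgue"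
    by (rule borel_measurable_if[symmetric]) simp
  ultimately show ?thesis by (simp only: Lp_def mem_Collect_eq)
qed

text \<open>The interval has finite measure, so \<open>1 + \<bar>f t\<bar> powr p\<close> is an
  integrable majorant.\<close>

lemma Lp_imp_integrable:
  assumes "1 \<le> p" "f \<in> Lp p a b"
  shows "integrable (lebesgue_on {a<..<b}) f"
proof (rule Bochner_Integration.integrable_bound)
  show "integrable (lebesgue_on {a<..<b}) (\<lambda>t. 1 + \<bar>f t\<bar> powr p)"
  proof (rule Bochner_Integration.integrable_add)
    show "integrable (lebesgue_on {a<..<b}) (\<lambda>t. 1::real)"
      by simp
    show "integrable (lebesgue_on {a<..<b}) (\<lambda>t. \<bar>f t\<bar> powr p)"
      using assms(2) by (simp add: Lp_def)
  qed
  show "f \<in> borel_measurable (lebesgue_on {a<..<b})" using assms(2) by (simp add: Lp_def)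
  have "\<bar>y\<bar> \<le> 1 + \<bar>y\<bar> powr p" for y :: real
  proof (cases "\<bar>y\<bar> \<le> 1")
    case False
    then show ?thesis using powr_mono[of 1 p "\<bar>y\<bar>"] assms(1) by simp
  qed (simp add: add_increasing2)
  then show "AE t in lebesgue_on {a<..<b}. norm (f t) \<le> norm (1 + \<bar>f t\<bar> powr p)"
    by (intro AE_I2) (smt (verit) real_norm_def)
qed

lemma bounded_measurable_in_Lp:
  assumes f: "f \<in> borel_measurable (lebesgue_on {a<..<b})" and "0 \<le> p"
    and bd: "\<And>t. t \<in> {a<..<b} \<Longrightarrow> \<bar>f t\<bar> \<le> C"
  shows "f \<in> Lp p a b"
proof -
  have "integrable (lebesgue_on {a<..<b}) (\<lambda>t. \<bar>f t\<bar> powr p)"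
  proof (rule measurable_bounded_by_integrable_imp_lebesgue_integrable)
    show "integrable (lebesgue_on {a<..<b}) (\<lambda>t. C powr p)"
      by simp
    show "(\<lambda>t. \<bar>f t\<bar> powr p) \<in> borel_measurable (lebesgue_on {a<..<b})"
      using f by measurable
    show "norm (\<bar>f t\<bar> powr p) \<le> C powr p" if "t \<in> {a<..<b}" for t
      using bd[OF that] \<open>0 \<le> p\<close> by (simp add: powr_mono2)
  qed simp
  then show ?thesis using f by (simp add: Lp_def)
qed

lemma Lp_add:
  assumes "f \<in> Lp p a b" "g \<in> Lp p a b" "0 \<le> p"
  shows "(\<lambda>t. f t + g t) \<in> Lp p a b"
proof -
  have m: "f \<in> borel_measurable (lebesgue_on {a<..<b})" "g \<in> borel_measurable (lebesgue_on {a<..<b})"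
    using assms by (auto simp: Lp_def)
  have "integrable (lebesgue_on {a<..<b}) (\<lambda>t. \<bar>f t + g t\<bar> powr p)"
  proof (rule Bochner_Integration.integrable_bound)
    show "integrable (lebesgue_on {a<..<b}) (\<lambda>t. 2 powr p * (\<bar>f t\<bar> powr p + \<bar>g t\<bar> powr p))"
      using assms by (simp add: Lp_def)
    show "(\<lambda>t. \<bar>f t + g t\<bar> powr p) \<in> borel_measurable (lebesgue_on {a<..<b})"
      using m by measurable
    have "\<bar>y + z\<bar> powr p \<le> 2 powr p * (\<bar>y\<bar> powr p + \<bar>z\<bar> powr p)" for y z :: real
    proof -
      have "\<bar>y + z\<bar> powr p \<le> (2 * max \<bar>y\<bar> \<bar>z\<bar>) powr p"
        using assms(3) by (intro powr_mono2) auto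
      also have "\<dots> = 2 powr p * max \<bar>y\<bar> \<bar>z\<bar> powr p" by (rule powr_mult)
      also have "max \<bar>y\<bar> \<bar>z\<bar> powr p \<le> \<bar>y\<bar> powr p + \<bar>z\<bar> powr p" by (auto simp: max_def)
      finally show ?thesis by simp
    qed
    then show "AE t in lebesgue_on {a<..<b}. norm (\<bar>f t + g t\<bar> powr p)
       \<le> norm (2 powr p * (\<bar>f t\<bar> powr p + \<bar>g t\<bar> powr p))"
      by simp
  qed
  then show ?thesis using m by (simp add: Lp_def)
qed

lemma Lp_cmult: "f \<in> Lp p a b \<Longrightarrow> (\<lambda>t. c * f t) \<in> Lp p a b"
  by (auto simp: Lp_def abs_mult powr_mult)

lemma Lp_sum:
  assumes "finite I" "\<And>i. i \<in> I \<Longrightarrow> f i \<in> Lp p a b" "0 \<le> p"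
  shows "(\<lambda>t. \<Sum>i\<in>I. f i t) \<in> Lp p a b"
  using assms
proof (induction I)
  case empty
  then show ?case by (auto intro: bounded_measurable_in_Lp[where C=0])
next
  case (insert i I)
  then show ?case by (simp add: Lp_add)
qed

text \<open>Serves both to extend data past its interval and, in \<open>Lp_subinterval\<close>, to
  restrict it.\<close>

lemma Lp_zero_extension:
  assumes "f \<in> Lp p c d"
  shows "(\<lambda>t. if t \<in> {c<..<d} then f t else 0) \<in> Lp p a b" (is "?f \<in> _")
proof -
  have m: "?f \<in> borel_measurable lebesgue" and i: "integrable lebesgue (\<lambda>t. \<bar>?f t\<bar> powr p)"
    using assms by (auto simp only: Lp_iff_zero_extension)
  have "integrable lebesgue (\<lambda>t. indicator {a<..<b} t *\<^sub>R \<bar>?f t\<bar> powr p)"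
    using i by (intro integrable_mult_indicator) auto
  then have "integrable (lebesgue_on {a<..<b}) (\<lambda>t. \<bar>?f t\<bar> powr p)"
    by (subst integrable_restrict_space) auto
  with measurable_restrict_space1[OF m] show ?thesis by (simp add: Lp_def)
qed

lemma Lp_shift:
  assumes "f \<in> Lp p a b"
  shows "(\<lambda>t. f (t - c)) \<in> Lp p (a + c) (b + c)"
proof -
  define g where "g t = (if t \<in> {a<..<b} then f t else 0)" for t
  have g: "g \<in> borel_measurable lebesgue" "integrable lebesgue (\<lambda>t. \<bar>g t\<bar> powr p)"
    using assms unfolding Lp_iff_zero_extension g_def[abs_def] by auto
  have eq: "(if t \<in> {a + c<..<b + c} then f (t - c) else 0) = g (- c + 1 * t)" for t
    by (auto simp: g_def)
  have "(\<lambda>t. g (- c + 1 * t)) \<in> borel_measurable lebesgue"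
    using borel_measurable_affine[OF g(1), of 1 "- c"] by simp
  moreover have "integrable lebesgue (\<lambda>t. \<bar>g (- c + 1 * t)\<bar> powr p)"
    using lebesgue_integrable_real_affine[OF g(2), of 1 "- c"] by simp
  ultimately show ?thesis by (simp only: Lp_iff_zero_extension eq)
qed

lemma Lp_cong: "(\<And>t. t \<in> {a<..<b} \<Longrightarrow> f t = g t) \<Longrightarrow> f \<in> Lp p a b \<longleftrightarrow> g \<in> Lp p a b"
  unfolding Lp_def mem_Collect_eq
  by (intro conj_cong measurable_cong Bochner_Integration.integrable_cong) auto

lemma Lp_subinterval:
  assumes "f \<in> Lp p a b" "a \<le> c" "d \<le> b"
  shows "f \<in> Lp p c d"
proof -
  have "(\<lambda>t. if t \<in> {a<..<b} then f t else 0) \<in> Lp p c d"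
    by (rule Lp_zero_extension[OF assms(1)])
  then show ?thesis using assms(2,3) by (subst Lp_cong[where g="\<lambda>t. if t \<in> {a<..<b} then f t else 0"]) auto
qed

lemma continuous_in_Lp:
  assumes f: "continuous_on {a..b} f" and "0 \<le> p"
  shows "f \<in> Lp p a b"
proof -
  obtain D where "\<And>t. t \<in> {a..b} \<Longrightarrow> \<bar>f t\<bar> \<le> D"
    using compact_imp_bounded[OF compact_continuous_image[OF f]] by (force simp: bounded_iff)
  moreover have "f \<in> borel_measurable (lebesgue_on {a<..<b})"
    by (rule continuous_imp_measurable_on_sets_lebesgue[OF continuous_on_subset[OF f]]) auto
  ultimately show ?thesis using assms(2) by (intro bounded_measurable_in_Lp[where C=D]) auto
qed

text \<open>Exceptional sets given as negligible sets can be united and translated; the delayed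
  argument requires the translation.\<close>

lemma AE_lebesgue_on_iff_negligible:
  fixes S :: "'a::euclidean_space set"
  assumes "S \<in> sets lebesgue"
  shows "(AE t in lebesgue_on S. P t) \<longleftrightarrow> (\<exists>N. negligible N \<and> (\<forall>t\<in>S - N. P t))"
proof -
  have "(AE t in lebesgue_on S. P t) \<longleftrightarrow> (AE t in lebesgue. t \<in> S \<longrightarrow> P t)"
    using assms by (simp add: AE_restrict_space_iff)
  also have "\<dots> \<longleftrightarrow> (\<exists>N. negligible N \<and> {t. \<not> (t \<in> S \<longrightarrow> P t)} \<subseteq> N)"
    by (rule eventually_ae_filter_negligible)
  also have "\<dots> \<longleftrightarrow> (\<exists>N. negligible N \<and> (\<forall>t\<in>S - N. P t))" by blast
  finally show ?thesis .
qed

text \<open>The set in \<open>(a,b)\<close> where two continuous functions differ is open, and an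
  open null set is empty. Continuity extends the equality to the endpoints.\<close>

lemma continuous_AE_eq_imp_eq:
  fixes f g :: "real \<Rightarrow> 'a::real_normed_vector"
  assumes "a < b" "continuous_on {a..b} f" "continuous_on {a..b} g"
    and ae: "AE t in lebesgue_on {a<..<b}. f t = g t" and "t \<in> {a..b}"
  shows "f t = g t"
proof -
  let ?d = "\<lambda>t. f t - g t"
  have cont: "continuous_on {a..b} ?d" using assms by (intro continuous_intros)
  let ?O = "{t \<in> {a<..<b}. ?d t \<in> - {0}}"
  have "open ?O"
    using continuous_on_subset[OF cont, of "{a<..<b}"]
      continuous_open_preimage[of "{a<..<b}" ?d "- {0}"] by (force simp: vimage_def Int_def)
  moreover have "negligible ?O"
  proof -
    have "AE t in lebesgue. t \<in> {a<..<b} \<longrightarrow> f t = g t"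
      using ae by (simp add: AE_restrict_space_iff)
    then obtain N where "negligible N" "{t. \<not> (t \<in> {a<..<b} \<longrightarrow> f t = g t)} \<subseteq> N"
      unfolding eventually_ae_filter_negligible by blast
    then show ?thesis by (elim negligible_subset) auto
  qed
  ultimately have "?O = {}" using open_not_negligible by blast
  then have "\<And>t. t \<in> {a<..<b} \<Longrightarrow> ?d t = 0" by auto
  then have "?d t = 0"
    using continuous_constant_on_closure[of "{a<..<b}" ?d 0 t] cont assms(1,5) by simp
  then show ?thesis by simp
qed

section \<open>Weak derivatives and primitives\<close>

lemma continuous_on_indefinite_integral:
  fixes g :: "real \<Rightarrow> real"
  assumes "integrable (lebesgue_on {a<..<b}) g"
  shows "g integrable_on {a..b}" "continuous_on {a..b} (\<lambda>t. integral {a..t} g)"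
proof -
  have "g integrable_on {a<..<b}" using assms by (simp add: integrable_on_lebesgue_on)
  then show "g integrable_on {a..b}"
    using integrable_on_open_interval_real[of g a b] by simp
  then show "continuous_on {a..b} (\<lambda>t. integral {a..t} g)"
    by (rule indefinite_integral_continuous_1)
qed

text \<open>Integration by parts shows that subtracting a primitive of \<open>g\<close> leaves a
  function with weak derivative 0, to which the lemma of du Bois-Reymond applies.\<close>

lemma sobolev_deriv_imp_primitive:
  assumes "1 \<le> p" "a < b" and sd: "sobolev_deriv p a b f g"
  obtains C where "AE t in lebesgue_on {a<..<b}. f t = C + integral {a..t} g"
proof -
  let ?S = "{a<..<b}"
  have f: "integrable (lebesgue_on ?S) f" and g: "integrable (lebesgue_on ?S) g"
    using sd assms(1) by (auto simp: sobolev_deriv_def intro: Lp_imp_integrable)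
  define G where "G t = integral {a..t} g" for t
  have Gc: "continuous_on {a..b} G"
    unfolding G_def by (rule continuous_on_indefinite_integral[OF g])
  have Gi: "integrable (lebesgue_on ?S) G"
  proof -
    have "integrable (lebesgue_on ?S) (\<lambda>t. 1::real)"
      by simp
    from integrable_lebesgue_on_mult_continuous[OF this Gc] show ?thesis by simp
  qed
  have "(LINT t|lebesgue_on ?S. (f t - G t) * deriv \<psi> t) = 0" if \<psi>: "test_function a b \<psi>" for \<psi>
  proof -
    have c: "continuous_on {a..b} (deriv \<psi>)" by (rule continuous_on_deriv_test_function[OF \<psi>])
    have "(LINT t|lebesgue_on ?S. (f t - G t) * deriv \<psi> t)
      = (LINT t|lebesgue_on ?S. f t * deriv \<psi> t) - (LINT t|lebesgue_on ?S. G t * deriv \<psi> t)"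
      using integrable_lebesgue_on_mult_continuous[OF f c] integrable_lebesgue_on_mult_continuous[OF Gi c]
      by (simp add: left_diff_distrib)
    also have "(LINT t|lebesgue_on ?S. G t * deriv \<psi> t) = - (LINT t|lebesgue_on ?S. g t * \<psi> t)"
      using integral_primitive_mult_deriv_test_function[OF \<open>a < b\<close> g \<psi>, of 0] by (simp add: G_def)
    also have "(LINT t|lebesgue_on ?S. f t * deriv \<psi> t) = - (LINT t|lebesgue_on ?S. g t * \<psi> t)"
      using sd \<psi> by (simp add: sobolev_deriv_def)
    finally show ?thesis by simp
  qed
  then obtain C where "AE t in lebesgue_on ?S. f t - G t = C"
    using weak_derivative_0_imp_AE_const[of a b "\<lambda>t. f t - G t"] \<open>a < b\<close> f Gi by auto
  then have "AE t in lebesgue_on ?S. f t = C + integral {a..t} g"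
    by eventually_elim (simp add: G_def)
  then show ?thesis by (rule that)
qed

lemma primitive_imp_sobolev_deriv:
  assumes "1 \<le> p" "a < b" and g: "g \<in> Lp p a b"
    and f: "\<And>t. t \<in> {a<..<b} \<Longrightarrow> f t = C + integral {a..t} g"
  shows "sobolev_deriv p a b f g"
proof -
  let ?S = "{a<..<b}"
  have gi: "integrable (lebesgue_on ?S) g"
    using g assms(1) by (rule Lp_imp_integrable[rotated])
  have c: "continuous_on {a..b} (\<lambda>t. C + integral {a..t} g)"
    by (intro continuous_intros continuous_on_indefinite_integral[OF gi])
  have c': "continuous_on ?S f"
    using continuous_on_subset[OF c greaterThanLessThan_subseteq_atLeastAtMost_iff[THEN iffD2]] f
    by (subst continuous_on_cong[OF refl f]) auto
  obtain D where D: "\<And>t. t \<in> {a..b} \<Longrightarrow> \<bar>C + integral {a..t} g\<bar> \<le> D"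
    using compact_imp_bounded[OF compact_continuous_image[OF c]] by (force simp: bounded_iff)
  have "f \<in> Lp p a b"
    using f D \<open>1 \<le> p\<close> c' 
    by (intro bounded_measurable_in_Lp[where C=D] continuous_imp_measurable_on_sets_lebesgue) auto
  moreover have "(LINT t|lebesgue_on ?S. f t * deriv \<psi> t) = - (LINT t|lebesgue_on ?S. g t * \<psi> t)"
    if \<psi>: "test_function a b \<psi>" for \<psi>
  proof -
    have "(LINT t|lebesgue_on ?S. f t * deriv \<psi> t)
        = (LINT t|lebesgue_on ?S. (C + integral {a..t} g) * deriv \<psi> t)"
      using f by (intro Bochner_Integration.integral_cong) auto
    then show ?thesis
      using integral_primitive_mult_deriv_test_function[OF \<open>a < b\<close> gi \<psi>] by simp
  qed
  ultimately show ?thesis using g by (simp add: sobolev_deriv_def)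
qed

section \<open>Vector-valued functions\<close>

lemma Lp_vec_add: "u \<in> Lp_vec p a b \<Longrightarrow> v \<in> Lp_vec p a b \<Longrightarrow> 0 \<le> p \<Longrightarrow> (\<lambda>t. u t + v t) \<in> Lp_vec p a b"
  by (simp add: Lp_vec_def Lp_add)

lemma Lp_vec_matrix_mult:
  assumes "u \<in> Lp_vec p a b" "0 \<le> p"
  shows "(\<lambda>t. A *v u t) \<in> Lp_vec p a b"
  using assms unfolding Lp_vec_def
  by (auto simp: matrix_vector_mult_def intro!: Lp_sum Lp_cmult)

lemma Lp_vec_zero_extension:
  "u \<in> Lp_vec p c d \<Longrightarrow> (\<lambda>t. if t \<in> {c<..<d} then u t else 0) \<in> Lp_vec p a b"
  unfolding Lp_vec_def using Lp_zero_extension[of _ p c d a b] by (simp add: if_distrib[where f="\<lambda>y. y $ _"] cong: if_cong)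

lemma Lp_vec_shift: "u \<in> Lp_vec p a b \<Longrightarrow> (\<lambda>t. u (t - c)) \<in> Lp_vec p (a + c) (b + c)"
  unfolding Lp_vec_def using Lp_shift[of "\<lambda>t. u t $ _" p a b c] by simp

lemma Lp_vec_subinterval: "u \<in> Lp_vec p a b \<Longrightarrow> a \<le> c \<Longrightarrow> d \<le> b \<Longrightarrow> u \<in> Lp_vec p c d"
  unfolding Lp_vec_def using Lp_subinterval by blast

lemma continuous_in_Lp_vec: "continuous_on {a..b} u \<Longrightarrow> 0 \<le> p \<Longrightarrow> u \<in> Lp_vec p a b"
  unfolding Lp_vec_def by (auto intro!: continuous_in_Lp continuous_intros)

lemma Lp_vec_imp_integrable_on:
  fixes u :: "real \<Rightarrow> real ^ 'n"
  assumes "u \<in> Lp_vec p a b" "1 \<le> p"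
  shows "u integrable_on {a..b}"
proof -
  have "(\<lambda>t. u t \<bullet> i) integrable_on {a..b}" if "i \<in> Basis" for i
  proof -
    obtain j where i: "i = axis j 1" using \<open>i \<in> Basis\<close> by (auto simp: Basis_vec_def)
    have "integrable (lebesgue_on {a<..<b}) (\<lambda>t. u t $ j)"
      using assms by (intro Lp_imp_integrable[of p]) (auto simp: Lp_vec_def)
    then have "(\<lambda>t. u t $ j) integrable_on {a..b}" by (rule continuous_on_indefinite_integral)
    then show ?thesis by (simp add: i inner_axis)
  qed
  then show ?thesis by (subst integrable_componentwise_iff) blast
qed

lemma integral_vec_nth:
  fixes u :: "real \<Rightarrow> real ^ 'n"
  assumes "u integrable_on S"
  shows "integral S u $ i = integral S (\<lambda>t. u t $ i)"
  using integral_component_eq[OF assms, of "axis i 1"] by (simp add: inner_axis)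

text \<open>Each component yields its own constant. The resulting continuous representative is
  compared at \<open>a\<close> with the one from the trace, which identifies the vector of constants
  as \<open>x\<close>.\<close>

lemma sobolev_deriv_vec_imp_primitive:
  fixes u w :: "real \<Rightarrow> real ^ 'n"
  assumes "1 \<le> p" "a < b" and sd: "sobolev_deriv_vec p a b u w" and tr: "right_trace a b u x"
  shows "w integrable_on {a..b}" "AE t in lebesgue_on {a<..<b}. u t = x + integral {a..t} w"
proof -
  have "w \<in> Lp_vec p a b"
    using sd by (simp add: sobolev_deriv_vec_def sobolev_deriv_def Lp_vec_def)
  then show wi: "w integrable_on {a..b}" using \<open>1 \<le> p\<close> by (rule Lp_vec_imp_integrable_on)
  have wt: "w integrable_on {a..t}" if "t \<le> b" for t
    using integrable_on_subinterval[OF wi, of a t] that by simp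
  have "\<exists>C. AE t in lebesgue_on {a<..<b}. u t $ i = C + integral {a..t} (\<lambda>s. w s $ i)" for i
    using sobolev_deriv_imp_primitive[OF assms(1,2)] sd unfolding sobolev_deriv_vec_def by metis
  then obtain C where C: "\<And>i. AE t in lebesgue_on {a<..<b}. u t $ i = C i + integral {a..t} (\<lambda>s. w s $ i)"
    by metis
  define y where "y = (\<chi> i. C i)"
  have "AE t in lebesgue_on {a<..<b}. \<forall>i. u t $ i = C i + integral {a..t} (\<lambda>s. w s $ i)"
    using C by (simp add: eventually_all_finite)
  moreover have "AE t in lebesgue_on {a<..<b}. t \<in> {a<..<b}" by (simp add: AE_restrict_space_iff)
  ultimately have y: "AE t in lebesgue_on {a<..<b}. u t = y + integral {a..t} w"
  proof eventually_elim
    case (elim t)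
    then have "u t $ i = (y + integral {a..t} w) $ i" for i
      using integral_vec_nth[OF wt[of t], of i] by (simp add: y_def)
    then show ?case by (simp only: vec_eq_iff) blast
  qed
  obtain g where g: "continuous_on {a..b} g" "AE t in lebesgue_on {a<..<b}. g t = u t" "g a = x"
    using tr by (auto simp: right_trace_def continuous_rep_def)
  have "AE t in lebesgue_on {a<..<b}. y + integral {a..t} w = g t"
    using y g(2) by eventually_elim simp
  then have "y + integral {a..a} w = g a"
    using assms(2) by (intro continuous_AE_eq_imp_eq[OF assms(2) _ g(1)] continuous_intros indefinite_integral_continuous_1 wi) auto
  then have "y = x" using g(3) by simp
  with y show "AE t in lebesgue_on {a<..<b}. u t = x + integral {a..t} w" by simp
qed

lemma primitive_imp_sobolev_deriv_vec:
  fixes u w :: "real \<Rightarrow> real ^ 'n"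
  assumes "1 \<le> p" "a < b" and w: "w \<in> Lp_vec p a b"
    and u: "\<And>t. t \<in> {a<..<b} \<Longrightarrow> u t = x + integral {a..t} w"
  shows "sobolev_deriv_vec p a b u w"
  unfolding sobolev_deriv_vec_def
proof
  fix i
  have wi: "w integrable_on {a..b}" by (rule Lp_vec_imp_integrable_on[OF w assms(1)])
  have wt: "w integrable_on {a..t}" if "t \<le> b" for t
    using integrable_on_subinterval[OF wi, of a t] that by simp
  show "sobolev_deriv p a b (\<lambda>t. u t $ i) (\<lambda>t. w t $ i)"
  proof (rule primitive_imp_sobolev_deriv[OF assms(1,2)])
    show "(\<lambda>t. w t $ i) \<in> Lp p a b" using w by (simp add: Lp_vec_def)
    show "u t $ i = x $ i + integral {a..t} (\<lambda>s. w s $ i)" if "t \<in> {a<..<b}" for t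
      using u[OF that] integral_vec_nth[OF wt[of t], of i] that by simp
  qed
qed

subsection \<open>The linear delay equation with a given forcing term\<close>

locale delay_system =
  fixes T :: real and A B :: "real ^ 'n ^ 'n" and x :: "real ^ 'n"
  assumes T_pos: "0 < T"
begin

text \<open>The delay term reads \<open>u\<close> from time 0 on only. For \<open>s < 2 * T\<close>
  the delayed value belongs to the initial data, which is accounted for in the forcing
  \<open>F\<close>.\<close>

definition rhs :: "(real \<Rightarrow> real ^ 'n) \<Rightarrow> (real \<Rightarrow> real ^ 'n) \<Rightarrow> real \<Rightarrow> real ^ 'n" where
  "rhs F u s = F s - B *v u s + (if s \<in> {2 * T..} then A *v u (s - 2 * T) else 0)"

definition solves :: "(real \<Rightarrow> real ^ 'n) \<Rightarrow> (real \<Rightarrow> real ^ 'n) \<Rightarrow> real \<Rightarrow> bool" where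
  "solves F u c \<longleftrightarrow> continuous_on {0..c} u \<and> (\<forall>t\<in>{0..c}. u t = x + integral {0..t} (rhs F u))"

text \<open>A Lipschitz bound for the instantaneous and the delayed term together. The summand 1
  makes it positive even for zero matrices, so that the weight \<open>exp (2 * L * t)\<close> is
  increasing.\<close>

definition L :: real where
  "L = onorm ((*v) A) + onorm ((*v) B) + 1"

lemma L_ge_1: "1 \<le> L"
  using onorm_pos_le[OF matrix_vector_mul_bounded_linear, of A]
    onorm_pos_le[OF matrix_vector_mul_bounded_linear, of B] by (simp add: L_def)

lemma rhs_integrable:
  assumes F: "F integrable_on {0..c}" and u: "continuous_on {0..c} u"
  shows "rhs F u integrable_on {0..c}"
proof -
  have "(\<lambda>s. B *v u s) integrable_on {0..c}"
    by (intro integrable_continuous_real linear_continuous_on_compose[OF u] matrix_vector_mul_linear)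
  moreover have "(\<lambda>s. if s \<in> {2 * T..} then A *v u (s - 2 * T) else 0) integrable_on {0..c}"
  proof -
    have "continuous_on {2*T..c} (\<lambda>s. u (s - 2 * T))"
      using T_pos by (intro continuous_on_compose2[OF u] continuous_intros) auto
    then have "(\<lambda>s. A *v u (s - 2 * T)) integrable_on {2*T..c}"
      by (intro integrable_continuous_real linear_continuous_on_compose[where g="(*v) A"] matrix_vector_mul_linear)
    moreover have "{2 * T..} \<inter> {0..c} = {2*T..c}" using T_pos by auto
    ultimately show ?thesis
      by (simp only: integrable_restrict_Int)
  qed
  ultimately show ?thesis
    unfolding rhs_def[abs_def]
    using F by (intro Henstock_Kurzweil_Integration.integrable_add Henstock_Kurzweil_Integration.integrable_diff)
qed

lemma rhs_integrable_initial:
  assumes "F integrable_on {0..c}" "continuous_on {0..c} u" "t \<le> c"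
  shows "rhs F u integrable_on {0..t}"
  using integrable_on_subinterval[OF rhs_integrable[OF assms(1,2)], of 0 t] assms(3) by simp

text \<open>The delayed difference is taken at an earlier time, where the increasing weight is
  smaller, so both terms obey a bound with the same weight.\<close>

lemma norm_rhs_diff_le:
  assumes bd: "\<And>r. r \<in> {0..s} \<Longrightarrow> norm (u r - v r) \<le> m * exp (2 * L * r)" and "0 \<le> s"
  shows "norm (rhs F u s - rhs F v s) \<le> L * m * exp (2 * L * s)"
proof -
  let ?a = "onorm ((*v) A)" and ?b = "onorm ((*v) B)"
  have pos: "0 \<le> ?a" "0 \<le> ?b" by (intro onorm_pos_le matrix_vector_mul_bounded_linear)+
  have m: "0 \<le> m"
    using order_trans[OF norm_ge_zero bd[of 0]] \<open>0 \<le> s\<close> by simp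
  have 1: "norm (B *v (u s - v s)) \<le> ?b * (m * exp (2 * L * s))"
    using onorm[OF matrix_vector_mul_bounded_linear, of B "u s - v s"] bd[of s] \<open>0 \<le> s\<close> pos
    by (meson atLeastAtMost_iff mult_left_mono order_refl order_trans)
  have 2: "norm (if s \<in> {2 * T..} then A *v (u (s - 2*T) - v (s - 2*T)) else 0) \<le> ?a * (m * exp (2 * L * s))"
  proof (cases "s \<in> {2 * T..}")
    case True
    have "norm (u (s - 2*T) - v (s - 2*T)) \<le> m * exp (2 * L * (s - 2 * T))"
      using True T_pos by (intro bd) auto
    also have "\<dots> \<le> m * exp (2 * L * s)"
      using m T_pos L_ge_1 by (intro mult_left_mono) auto
    finally show ?thesis
      using True onorm[OF matrix_vector_mul_bounded_linear, of A "u (s - 2*T) - v (s - 2*T)"] pos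
      by (auto intro: order_trans mult_left_mono)
  next
    case False
    then show ?thesis using pos m by simp
  qed
  have "rhs F u s - rhs F v s = - (B *v (u s - v s))
      + (if s \<in> {2 * T..} then A *v (u (s - 2*T) - v (s - 2*T)) else 0)"
    by (simp add: rhs_def matrix_vector_mult_diff_distrib)
  then have "norm (rhs F u s - rhs F v s) \<le> norm (B *v (u s - v s))
      + norm (if s \<in> {2 * T..} then A *v (u (s - 2*T) - v (s - 2*T)) else 0)"
    using norm_triangle_ineq norm_minus_cancel by metis
  also have "\<dots> \<le> (?a + ?b) * (m * exp (2 * L * s))"
    using 1 2 by (simp add: distrib_right)
  also have "\<dots> \<le> L * (m * exp (2 * L * s))"
    using m by (intro mult_right_mono) (auto simp: L_def)
  finally show ?thesis by (simp add: mult.assoc)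
qed

text \<open>In the weight \<open>exp (2 * L * t)\<close> the Volterra operator is a contraction on every
  interval \<open>[0,c]\<close>, so no continuation argument and no method of steps is needed.\<close>

lemma norm_integral_rhs_diff_le:
  assumes F: "F integrable_on {0..c}" and u: "continuous_on {0..c} u" and v: "continuous_on {0..c} v"
    and bd: "\<And>r. r \<in> {0..c} \<Longrightarrow> norm (u r - v r) \<le> m * exp (2 * L * r)" and t: "t \<in> {0..c}"
  shows "norm (integral {0..t} (rhs F u) - integral {0..t} (rhs F v)) \<le> m / 2 * exp (2 * L * t)"
proof -
  have m: "0 \<le> m"
    using order_trans[OF norm_ge_zero bd[of 0]] t by simp
  have ui: "rhs F u integrable_on {0..t}" and vi: "rhs F v integrable_on {0..t}"
    using F u v t by (auto intro: rhs_integrable_initial)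
  \<comment> \<open>Integrating the weight divides by \<open>2 * L\<close>; against the Lipschitz
    factor \<open>L\<close> this leaves the contraction factor 1/2.\<close>
  have I: "((\<lambda>s. L * m * exp (2 * L * s)) has_integral (m / 2 * exp (2 * L * t) - m / 2 * exp (2 * L * 0))) {0..t}"
    using t L_ge_1 by (intro fundamental_theorem_of_calculus)
      (auto intro!: derivative_eq_intros simp: has_real_derivative_iff_has_vector_derivative[symmetric])
  have "norm (integral {0..t} (\<lambda>s. rhs F u s - rhs F v s)) \<le> integral {0..t} (\<lambda>s. L * m * exp (2 * L * s))"
  proof (rule integral_norm_bound_integral)
    show "(\<lambda>s. rhs F u s - rhs F v s) integrable_on {0..t}"
      using ui vi by (rule Henstock_Kurzweil_Integration.integrable_diff)
    show "(\<lambda>s. L * m * exp (2 * L * s)) integrable_on {0..t}" using I by blast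
    show "norm (rhs F u s - rhs F v s) \<le> L * m * exp (2 * L * s)" if "s \<in> {0..t}" for s
      using that t by (intro norm_rhs_diff_le bd) auto
  qed
  also have "\<dots> \<le> m / 2 * exp (2 * L * t)"
    using m by (simp only: integral_unique[OF I]) simp
  finally show ?thesis
    by (simp only: Henstock_Kurzweil_Integration.integral_diff[OF ui vi])
qed

text \<open>A bound \<open>D\<close> for the difference improves to \<open>D / 2 ^ n\<close> in the
  weighted norm when the contraction is applied \<open>n\<close> times.\<close>

lemma solves_unique:
  assumes F: "F integrable_on {0..c}" and u: "solves F u c" and v: "solves F v c" and t: "t \<in> {0..c}"
  shows "u t = v t"
proof -
  have uc: "continuous_on {0..c} u" and vc: "continuous_on {0..c} v"
    using u v by (auto simp: solves_def)
  obtain D where D: "\<And>r. r \<in> {0..c} \<Longrightarrow> norm (u r - v r) \<le> D"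
    using compact_imp_bounded[OF compact_continuous_image[OF continuous_on_diff[OF uc vc]]]
    by (force simp: bounded_iff)
  have "norm (u r - v r) \<le> D / 2 ^ n * exp (2 * L * r)" if "r \<in> {0..c}" for n r
    using that
  proof (induction n arbitrary: r)
    case 0
    have "0 \<le> D" using order_trans[OF norm_ge_zero D[OF 0]] .
    then have "D * 1 \<le> D * exp (2 * L * r)"
      using L_ge_1 0 by (intro mult_left_mono) auto
    then show ?case using D[OF 0] by simp
  next
    case (Suc n)
    have "norm (integral {0..r} (rhs F u) - integral {0..r} (rhs F v)) \<le> D / 2 ^ n / 2 * exp (2 * L * r)"
      by (intro norm_integral_rhs_diff_le[OF F uc vc] Suc)
    moreover have "u r - v r = integral {0..r} (rhs F u) - integral {0..r} (rhs F v)"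
      using u v Suc.prems unfolding solves_def by fastforce
    ultimately have "norm (u r - v r) \<le> D / 2 ^ n / 2 * exp (2 * L * r)" by (simp only:)
    then show ?case by simp
  qed
  then have le: "norm (u t - v t) \<le> D / 2 ^ n * exp (2 * L * t)" for n
    using t by blast
  have "(\<lambda>n. D * (1/2) ^ n * exp (2 * L * t)) \<longlonglongrightarrow> D * 0 * exp (2 * L * t)"
    by (intro tendsto_intros LIMSEQ_power_zero) auto
  then have "norm (u t - v t) \<le> 0"
    using le by (intro LIMSEQ_le_const) (auto simp: power_one_over)
  then show ?thesis by simp
qed

section \<open>Existence by Picard iteration\<close>

primrec iter :: "(real \<Rightarrow> real ^ 'n) \<Rightarrow> nat \<Rightarrow> real \<Rightarrow> real ^ 'n" where
  "iter F 0 t = x"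
| "iter F (Suc n) t = x + integral {0..t} (rhs F (iter F n))"

text \<open>The limit of the iterates, written as a telescoping series. It refers to no interval, so
  a single function serves every horizon \<open>c\<close>.\<close>

definition sol :: "(real \<Rightarrow> real ^ 'n) \<Rightarrow> real \<Rightarrow> real ^ 'n" where
  "sol F t = x + (\<Sum>n. iter F (Suc n) t - iter F n t)"

lemma continuous_on_iter:
  assumes "F integrable_on {0..c}"
  shows "continuous_on {0..c} (iter F n)"
proof (induction n)
  case 0
  then show ?case by (simp add: iter.simps(1)[abs_def] cong: continuous_on_cong)
next
  case (Suc n)
  have "continuous_on {0..c} (\<lambda>t. x + integral {0..t} (rhs F (iter F n)))"
    by (intro continuous_intros indefinite_integral_continuous_1 rhs_integrable assms Suc)
  then show ?case by (simp cong: continuous_on_cong)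
qed

text \<open>The contraction gives successive iterates a geometric majorant in the weighted norm; on
  \<open>[0,c]\<close> the weight is at most \<open>exp (2 * L * c)\<close>, and the Weierstrass
  test applies.\<close>

lemma uniform_limit_iter:
  assumes F: "F integrable_on {0..c}"
  shows "uniform_limit {0..c} (iter F) (sol F) sequentially"
proof -
  let ?d = "\<lambda>n t. iter F (Suc n) t - iter F n t"
  obtain D where D: "\<And>r. r \<in> {0..c} \<Longrightarrow> norm (?d 0 r) \<le> D"
    using compact_imp_bounded[OF compact_continuous_image[OF
        continuous_on_diff[OF continuous_on_iter[OF F, of 1] continuous_on_iter[OF F, of 0]]]]
    by (force simp: bounded_iff)
  have d: "norm (?d n r) \<le> D / 2 ^ n * exp (2 * L * r)" if "r \<in> {0..c}" for n r
    using that
  proof (induction n arbitrary: r)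
    case 0
    have "0 \<le> D" using order_trans[OF norm_ge_zero D[OF 0]] .
    then have "D * 1 \<le> D * exp (2 * L * r)"
      using L_ge_1 0 by (intro mult_left_mono) auto
    then show ?case using D[OF 0] by (simp del: iter.simps)
  next
    case (Suc n)
    have "norm (integral {0..r} (rhs F (iter F (Suc n))) - integral {0..r} (rhs F (iter F n)))
        \<le> D / 2 ^ n / 2 * exp (2 * L * r)"
      by (intro norm_integral_rhs_diff_le[OF F continuous_on_iter[OF F] continuous_on_iter[OF F]] Suc)
    then show ?case by (simp add: field_simps)
  qed
  have "uniform_limit {0..c} (\<lambda>n t. \<Sum>i<n. ?d i t) (\<lambda>t. suminf (\<lambda>i. ?d i t)) sequentially"
  proof (rule Weierstrass_m_test)
    show "norm (?d n t) \<le> D * exp (2 * L * c) * (1/2) ^ n" if "t \<in> {0..c}" for n t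
    proof -
      have "0 \<le> D" using order_trans[OF norm_ge_zero D[OF that]] .
      then have "D / 2 ^ n * exp (2 * L * t) \<le> D / 2 ^ n * exp (2 * L * c)"
        using L_ge_1 that by (intro mult_left_mono) auto
      then show ?thesis using d[OF that, of n] by (simp add: power_one_over field_simps del: iter.simps)
    qed
    show "summable (\<lambda>n. D * exp (2 * L * c) * (1/2) ^ n)"
      by (intro summable_mult summable_geometric) auto
  qed
  then have "uniform_limit {0..c} (\<lambda>n t. x + (\<Sum>i<n. ?d i t)) (sol F) sequentially"
    unfolding sol_def[abs_def] by (intro uniform_limit_add uniform_limit_const)
  moreover have "x + (\<Sum>i<n. ?d i t) = iter F n t" for n t
    using sum_lessThan_telescope[of "\<lambda>i. iter F i t" n] by simp
  ultimately show ?thesis by (simp only:)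
qed

text \<open>The recursion of the iterates passes to the limit: uniform convergence makes the
  integrals converge by the contraction estimate.\<close>

lemma solves_sol:
  assumes F: "F integrable_on {0..c}"
  shows "solves F (sol F) c"
proof -
  have cont: "continuous_on {0..c} (sol F)"
    by (rule uniform_limit_theorem[OF _ uniform_limit_iter[OF F]]) (auto intro: always_eventually continuous_on_iter[OF F])
  have "sol F t = x + integral {0..t} (rhs F (sol F))" if t: "t \<in> {0..c}" for t
  proof -
    have lim: "(\<lambda>n. iter F n t) \<longlonglongrightarrow> sol F t"
      using tendsto_uniform_limitI[OF uniform_limit_iter[OF F] t] .
    have "(\<lambda>n. integral {0..t} (rhs F (iter F n))) \<longlonglongrightarrow> integral {0..t} (rhs F (sol F))"
    proof (rule tendstoI)
      fix e :: real assume "0 < e"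
      \<comment> \<open>Chosen so that the contraction estimate yields \<open>e / 2 < e\<close>.
        Closeness in the plain norm implies closeness in the weighted one, the weight being at least
        1.\<close>
      define e' where "e' = e / exp (2 * L * t)"
      have "0 < e'" using \<open>0 < e\<close> by (simp add: e'_def)
      then have "\<forall>\<^sub>F n in sequentially. \<forall>r\<in>{0..c}. dist (iter F n r) (sol F r) < e'"
        using uniform_limit_iter[OF F] by (simp add: uniform_limit_iff)
      then show "\<forall>\<^sub>F n in sequentially. dist (integral {0..t} (rhs F (iter F n))) (integral {0..t} (rhs F (sol F))) < e"
      proof eventually_elim
        case (elim n)
        have "norm (integral {0..t} (rhs F (iter F n)) - integral {0..t} (rhs F (sol F))) \<le> e' / 2 * exp (2 * L * t)"
        proof (rule norm_integral_rhs_diff_le[OF F continuous_on_iter[OF F] cont _ t])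
          fix r assume r: "r \<in> {0..c}"
          have "norm (iter F n r - sol F r) \<le> e' * 1" using elim r by (force simp: dist_norm)
          also have "\<dots> \<le> e' * exp (2 * L * r)"
            using \<open>0 < e'\<close> L_ge_1 r by (intro mult_left_mono) auto
          finally show "norm (iter F n r - sol F r) \<le> e' * exp (2 * L * r)" .
        qed
        also have "\<dots> < e" using \<open>0 < e\<close> by (simp add: e'_def)
        finally show ?case by (simp add: dist_norm)
      qed
    qed
    then have "(\<lambda>n. iter F (Suc n) t) \<longlonglongrightarrow> x + integral {0..t} (rhs F (sol F))"
      by (simp add: tendsto_intros)
    then show ?thesis
      using LIMSEQ_unique LIMSEQ_Suc[OF lim] by blast
  qed
  with cont show ?thesis by (simp add: solves_def)
qed

lemma solves_initial: "solves F u c \<Longrightarrow> d \<le> c \<Longrightarrow> solves F u d"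
  by (auto simp: solves_def intro: continuous_on_subset)

lemma solves_0: "solves F u c \<Longrightarrow> 0 \<le> c \<Longrightarrow> u 0 = x"
  by (auto simp: solves_def)

lemma solves_AE_cong:
  assumes u: "solves F u c" and N: "negligible N" and eq: "\<And>s. s \<in> {0..c} - N \<Longrightarrow> F s = F' s"
  shows "solves F' u c"
proof -
  have "integral {0..t} (rhs F u) = integral {0..t} (rhs F' u)" if "t \<in> {0..c}" for t
    using that eq by (intro integral_spike[OF N]) (auto simp: rhs_def)
  then show ?thesis using u by (simp add: solves_def)
qed

text \<open>The single time \<open>c\<close> does not affect the integral. Leaving it out of the
  agreement hypothesis later allows a control at a time to be defined by the response at that same
  time.\<close>

lemma solves_unique_forcing:
  assumes F: "F integrable_on {0..c}" and u: "solves F u c" and v: "solves F' v c"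
    and eq: "\<And>s. s \<in> {0..<c} \<Longrightarrow> F' s = F s" and t: "t \<in> {0..c}"
  shows "u t = v t"
proof (rule solves_unique[OF F u _ t])
  show "solves F v c"
    by (rule solves_AE_cong[OF v, of "{c}"]) (use eq in auto)
qed

end

subsection \<open>The hysteresis operator\<close>

text \<open>Let \<open>S\<close> be the supremum of the times up to which \<open>P\<close> holds
  throughout: \<open>left\<close> gives \<open>P S\<close>, and \<open>right\<close> excludes
  \<open>S < c\<close>.\<close>

lemma interval_induct:
  fixes P :: "real \<Rightarrow> bool"
  assumes "0 \<le> c" and init: "P 0"
    and right: "\<And>t. \<lbrakk>0 \<le> t; t < c; \<And>s. s \<in> {0..t} \<Longrightarrow> P s\<rbrakk> \<Longrightarrow> \<exists>\<epsilon>>0. \<forall>s\<in>{t..t+\<epsilon>}. s \<le> c \<longrightarrow> P s"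
    and left: "\<And>t. \<lbrakk>0 < t; t \<le> c; \<And>s. s \<in> {0..<t} \<Longrightarrow> P s\<rbrakk> \<Longrightarrow> P t"
    and t: "t \<in> {0..c}"
  shows "P t"
proof -
  define E where "E = {r \<in> {0..c}. \<forall>s\<in>{0..r}. P s}"
  have E: "0 \<in> E" "bdd_above E" using \<open>0 \<le> c\<close> init by (auto simp: E_def)
  define S where "S = Sup E"
  have "S \<le> c" unfolding S_def using E(1) by (intro cSup_least) (auto simp: E_def)
  with cSup_upper[OF E] have S: "0 \<le> S" "S \<le> c" by (simp_all add: S_def)
  have below: "P s" if s: "s \<in> {0..<S}" for s
  proof -
    obtain r where "r \<in> E" "s < r"
      using s less_cSupD[of E s] E(1) unfolding S_def by auto
    then show ?thesis using s by (auto simp: E_def)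
  qed
  have PS: "P S"
    using left[of S] below init S by (cases "S = 0") auto
  then have upto: "P s" if "s \<in> {0..S}" for s using below that by (cases "s = S") auto
  have "S = c"
  proof (rule ccontr)
    assume "S \<noteq> c"
    then obtain \<epsilon> where \<epsilon>: "\<epsilon> > 0" "\<forall>s\<in>{S..S+\<epsilon>}. s \<le> c \<longrightarrow> P s"
      using right[of S] S upto by auto
    define r where "r = min c (S + \<epsilon>)"
    have "P s" if "s \<in> {0..r}" for s
      using upto[of s] \<epsilon>(2) that by (cases "s \<le> S") (auto simp: r_def)
    then have "r \<in> E" using S \<epsilon>(1) by (auto simp: E_def r_def)
    then have "r \<le> S" unfolding S_def using E(2) by (rule cSup_upper)
    then show False using \<open>S \<noteq> c\<close> S \<epsilon>(1) by (auto simp: r_def)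
  qed
  then show ?thesis using upto t by simp
qed

section \<open>The relay under continuous input\<close>

context
  fixes \<alpha> \<beta> :: real
  assumes \<alpha>\<beta>: "\<alpha> < \<beta>"
begin

lemma hysteresis_values: "hysteresis \<alpha> \<beta> g t \<in> {-1, 1}"
  by (simp add: hysteresis_def)

lemma hysteresis_eq:
  assumes "m \<in> switch_times \<alpha> \<beta> g t" "\<And>s. s \<in> switch_times \<alpha> \<beta> g t \<Longrightarrow> s \<le> m"
  shows "hysteresis \<alpha> \<beta> g t = (if g m = \<alpha> then 1 else -1)"
proof -
  have "(GREATEST s. s \<in> switch_times \<alpha> \<beta> g t) = m"
    using assms by (intro Greatest_equality) auto
  then show ?thesis using assms(1) by (auto simp: hysteresis_def)
qed

text \<open>Time 0 is excluded from \<open>switch_times\<close>, so this set need not be closed; its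
  part from any one switching time \<open>s0\<close> on is compact.\<close>

lemma switch_times_max:
  assumes g: "continuous_on {0..t} g" and ne: "switch_times \<alpha> \<beta> g t \<noteq> {}"
  obtains m where "m \<in> switch_times \<alpha> \<beta> g t" "\<And>s. s \<in> switch_times \<alpha> \<beta> g t \<Longrightarrow> s \<le> m"
proof -
  obtain s0 where s0: "s0 \<in> switch_times \<alpha> \<beta> g t" using ne by blast
  let ?X = "{s \<in> {s0..t}. g s \<in> {\<alpha>, \<beta>}}"
  have c: "continuous_on {s0..t} g"
    using s0 by (intro continuous_on_subset[OF g]) (auto simp: switch_times_def)
  have "closed ?X"
    using continuous_closed_preimage[OF c closed_atLeastAtMost, of "{\<alpha>, \<beta>}"]
    by (simp add: vimage_def Int_def)
  moreover have "bounded ?X" by (rule bounded_subset[of "{s0..t}"]) auto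
  ultimately have "compact ?X" by (simp add: compact_eq_bounded_closed)
  moreover have "?X \<noteq> {}" using s0 by (auto simp: switch_times_def)
  ultimately obtain m where m: "m \<in> ?X" "\<And>s. s \<in> ?X \<Longrightarrow> s \<le> m"
    using compact_attains_sup[of ?X] by blast
  show ?thesis
  proof (rule that)
    show "m \<in> switch_times \<alpha> \<beta> g t" using m(1) s0 by (auto simp: switch_times_def)
    show "s \<le> m" if "s \<in> switch_times \<alpha> \<beta> g t" for s
      using that m by (cases "s0 \<le> s") (auto simp: switch_times_def)
  qed
qed

lemma hysteresis_cong:
  assumes g: "continuous_on {0..t} g" and eq: "\<And>s. s \<in> {0..t} \<Longrightarrow> g s = g' s" and "0 \<le> t"
  shows "hysteresis \<alpha> \<beta> g t = hysteresis \<alpha> \<beta> g' t"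
proof -
  have st: "switch_times \<alpha> \<beta> g t = switch_times \<alpha> \<beta> g' t"
    using eq by (auto simp: switch_times_def)
  show ?thesis
  proof (cases "switch_times \<alpha> \<beta> g t = {}")
    case True
    then show ?thesis using st eq[of 0] \<open>0 \<le> t\<close> by (simp add: hysteresis_def)
  next
    case False
    then obtain m where m: "m \<in> switch_times \<alpha> \<beta> g t" "\<And>s. s \<in> switch_times \<alpha> \<beta> g t \<Longrightarrow> s \<le> m"
      using switch_times_max[OF g] by blast
    moreover have "g m = g' m" using m(1) eq by (auto simp: switch_times_def)
    ultimately show ?thesis
      using hysteresis_eq[of m g t] hysteresis_eq[of m g' t] unfolding st by simp
  qed
qed

text \<open>For \<open>t > 0\<close> reaching a threshold is itself a switching event at
  \<open>t\<close>. At \<open>t = 0\<close> the strict inequality in the initial rule assigns -1 to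
  the input \<open>\<beta>\<close> and 1 to the input \<open>\<alpha>\<close>.\<close>

lemma hysteresis_not_at_threshold:
  assumes "0 \<le> t" "g t = (if hysteresis \<alpha> \<beta> g t = 1 then \<beta> else \<alpha>)"
  shows False
proof (cases "t = 0")
  case True
  then have "switch_times \<alpha> \<beta> g t = {}" by (auto simp: switch_times_def)
  then show False using assms True \<alpha>\<beta> by (auto simp: hysteresis_def split: if_splits)
next
  case False
  then have "hysteresis \<alpha> \<beta> g t = (if g t = \<alpha> then 1 else -1)"
    using assms by (intro hysteresis_eq) (auto simp: switch_times_def split: if_splits)
  then show False using assms \<alpha>\<beta> by (auto split: if_splits)
qed

text \<open>Only the threshold \<open>\<gamma>\<close> can change the current state, and by
  continuity the input avoids it for a while. Hits of the other threshold merely confirm the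
  state.\<close>

lemma hysteresis_right_constant:
  assumes g: "continuous_on {0..c} g" and S: "0 \<le> S" "S < c"
  obtains \<epsilon> where "0 < \<epsilon>" "S + \<epsilon> \<le> c" "\<And>t. t \<in> {S..S+\<epsilon>} \<Longrightarrow> hysteresis \<alpha> \<beta> g t = hysteresis \<alpha> \<beta> g S"
proof -
  define \<gamma> where "\<gamma> = (if hysteresis \<alpha> \<beta> g S = 1 then \<beta> else \<alpha>)"
  have "g S \<noteq> \<gamma>" using hysteresis_not_at_threshold[of S g] S(1) by (auto simp: \<gamma>_def)
  then have "0 < dist (g S) \<gamma>" by simp
  then obtain d where d: "d > 0" "\<And>s. s \<in> {0..c} \<Longrightarrow> dist s S < d \<Longrightarrow> dist (g s) (g S) < dist (g S) \<gamma>"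
    using g S unfolding continuous_on_iff by (metis atLeastAtMost_iff less_eq_real_def)
  define \<epsilon> where "\<epsilon> = min (d / 2) (c - S)"
  have \<epsilon>: "0 < \<epsilon>" "\<epsilon> < d" "S + \<epsilon> \<le> c" using d(1) S by (auto simp: \<epsilon>_def)
  have avoid: "g s \<noteq> \<gamma>" if "s \<in> {S..S+\<epsilon>}" for s
    using d(2)[of s] that \<epsilon> S by (auto simp: dist_real_def)
  have "hysteresis \<alpha> \<beta> g t = hysteresis \<alpha> \<beta> g S" if t: "t \<in> {S..S+\<epsilon>}" for t
  proof (cases "\<exists>s\<in>switch_times \<alpha> \<beta> g t. S < s")
    case True
    have gt: "continuous_on {0..t} g"
      by (rule continuous_on_subset[OF g]) (use t \<epsilon> in auto)
    obtain m where m: "m \<in> switch_times \<alpha> \<beta> g t" "\<And>s. s \<in> switch_times \<alpha> \<beta> g t \<Longrightarrow> s \<le> m"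
      using switch_times_max[OF gt] True by blast
    then have "S < m" using True by force
    then have "m \<in> {S..S+\<epsilon>}" using m(1) t by (auto simp: switch_times_def)
    from avoid[OF this] have "g m = (if hysteresis \<alpha> \<beta> g S = 1 then \<alpha> else \<beta>)"
      using m(1) by (auto simp: \<gamma>_def switch_times_def split: if_splits)
    then show ?thesis
      using hysteresis_eq[OF m] hysteresis_values[of g S] \<alpha>\<beta> by (auto split: if_splits)
  next
    case False
    then have "switch_times \<alpha> \<beta> g t = switch_times \<alpha> \<beta> g S"
      using t by (fastforce simp: switch_times_def)
    then show ?thesis by (simp add: hysteresis_def)
  qed
  then show ?thesis using that \<epsilon> by blast
qed

end

subsection \<open>The closed loop\<close>

locale hysteresis_system = delay_system T A B x
  for T :: real and A B :: "real ^ 'n ^ 'n" and x :: "real ^ 'n" +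
  fixes \<alpha> \<beta> :: real and k :: "real ^ 'n" and M :: "real ^ 'n \<Rightarrow> real" and f :: "real \<Rightarrow> real ^ 'n"
  assumes thresholds: "\<alpha> < \<beta>" and M: "linear M" and f: "\<And>c. f integrable_on {0..c}"
begin

abbreviation relay :: "(real \<Rightarrow> real ^ 'n) \<Rightarrow> real \<Rightarrow> real" where
  "relay u \<equiv> hysteresis \<alpha> \<beta> (\<lambda>t. M (u t))"

definition forcing :: "(real \<Rightarrow> real) \<Rightarrow> real \<Rightarrow> real ^ 'n" where
  "forcing z t = z t *\<^sub>R k + f t"

text \<open>Borel measurability survives pasting and pointwise limits. The bound 1, in place of the
  two values -1 and 1, admits signals set to 0 outside an interval.\<close>

definition control :: "(real \<Rightarrow> real) \<Rightarrow> bool" where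
  "control z \<longleftrightarrow> z \<in> borel_measurable borel \<and> (\<forall>t. \<bar>z t\<bar> \<le> 1)"

lemma forcing_integrable:
  assumes "control z"
  shows "forcing z integrable_on {0..c}"
proof -
  have "(\<lambda>t. z t *\<^sub>R k) integrable_on {0..c}"
  proof -
    have "z \<in> borel_measurable lebesgue"
      using assms by (simp add: control_def measurable_completion)
    then have m: "z \<in> borel_measurable (lebesgue_on {0..c})" by (rule measurable_restrict_space1)
    have "z integrable_on {0..c}"
      by (rule measurable_bounded_by_integrable_imp_integrable[OF m, of "\<lambda>_. 1"])
        (use assms in \<open>auto simp: control_def\<close>)
    then show ?thesis by (rule integrable_on_scaleR_left)
  qed
  then show ?thesis
    unfolding forcing_def[abs_def] using f by (rule Henstock_Kurzweil_Integration.integrable_add)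
qed

abbreviation response :: "(real \<Rightarrow> real) \<Rightarrow> real \<Rightarrow> real ^ 'n" where
  "response z \<equiv> sol (forcing z)"

lemma solves_response: "control z \<Longrightarrow> solves (forcing z) (response z) c"
  by (intro solves_sol forcing_integrable)

lemma continuous_on_M: "continuous_on S u \<Longrightarrow> continuous_on S (\<lambda>t::real. M (u t))"
  using linear_continuous_on_compose[of S u M] M by simp

lemma solves_continuous_on: "solves F u c \<Longrightarrow> continuous_on {0..c} u"
  by (simp add: solves_def)

lemma continuous_on_M_response: "control z \<Longrightarrow> continuous_on {0..c} (\<lambda>t. M (response z t))"
  by (intro continuous_on_M solves_continuous_on[OF solves_response])

lemma response_causal:
  assumes "control z" "control z'" "\<And>s. s \<in> {0..<c} \<Longrightarrow> z' s = z s" "t \<in> {0..c}"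
  shows "response z t = response z' t"
  by (rule solves_unique_forcing[OF forcing_integrable[OF assms(1)] solves_response solves_response])
    (use assms in \<open>auto simp: forcing_def\<close>)

text \<open>Strict causality: the control before \<open>t\<close> already fixes the response up to
  and including \<open>t\<close>, which is all that the relay reads.\<close>

lemma relay_response_causal:
  assumes "control z" "control z'" "\<And>s. s \<in> {0..<t} \<Longrightarrow> z' s = z s" "0 \<le> t"
  shows "relay (response z) t = relay (response z') t"
proof (rule hysteresis_cong[OF thresholds continuous_on_M_response[OF assms(1)] _ assms(4)])
  show "M (response z s) = M (response z' s)" if "s \<in> {0..t}" for s
    using response_causal[OF assms(1-3), of t s] that by simp
qed

text \<open>Two closed-loop solutions that agree up to a time \<open>t\<close> have the same relay state at \<open>t\<close>, and
  both relay states stay constant for a while, hence the solutions still agree for a while.\<close>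

lemma closed_loop_unique:
  assumes u: "solves (forcing z) u c" and v: "solves (forcing z') v c"
    and z: "forcing z integrable_on {0..c}"
    and zu: "\<And>t. t \<in> {0..c} \<Longrightarrow> z t = relay u t" and zv: "\<And>t. t \<in> {0..c} \<Longrightarrow> z' t = relay v t"
    and c: "0 \<le> c" and t: "t \<in> {0..c}"
  shows "u t = v t"
proof (rule interval_induct[OF c _ _ _ t])
  note uc = solves_continuous_on[OF u] and vc = solves_continuous_on[OF v]
  show "u 0 = v 0" using solves_0[OF u c] solves_0[OF v c] by simp
  show "u t = v t" if "0 < t" "t \<le> c" and eq: "\<And>s. s \<in> {0..<t} \<Longrightarrow> u s = v s" for t
  proof -
    have "continuous_on {0..t} (\<lambda>s. u s - v s)"
      using that by (intro continuous_on_diff continuous_on_subset[OF uc] continuous_on_subset[OF vc]) auto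
    then have "u t - v t = 0"
      using continuous_constant_on_closure[of "{0..<t}" "\<lambda>s. u s - v s" 0 t] that by simp
    then show ?thesis by simp
  qed
  show "\<exists>\<epsilon>>0. \<forall>s\<in>{t..t+\<epsilon>}. s \<le> c \<longrightarrow> u s = v s"
    if t: "0 \<le> t" "t < c" and eq: "\<And>s. s \<in> {0..t} \<Longrightarrow> u s = v s" for t
  proof -
    obtain \<epsilon>1 where \<epsilon>1: "0 < \<epsilon>1" "t + \<epsilon>1 \<le> c" "\<And>s. s \<in> {t..t+\<epsilon>1} \<Longrightarrow> relay u s = relay u t"
      using hysteresis_right_constant[OF thresholds continuous_on_M[OF uc] t] by blast
    obtain \<epsilon>2 where \<epsilon>2: "0 < \<epsilon>2" "t + \<epsilon>2 \<le> c" "\<And>s. s \<in> {t..t+\<epsilon>2} \<Longrightarrow> relay v s = relay v t"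
      using hysteresis_right_constant[OF thresholds continuous_on_M[OF vc] t] by blast
    define d where "d = t + min \<epsilon>1 \<epsilon>2"
    have d: "d \<le> c" using \<epsilon>1(2) by (auto simp: d_def)
    have rel: "relay u s = relay v s" if "s \<in> {0..t}" for s
    proof (rule hysteresis_cong[OF thresholds continuous_on_M])
      show "continuous_on {0..s} u" using that t by (intro continuous_on_subset[OF uc]) auto
    qed (use eq that in auto)
    have zz: "z' s = z s" if "s \<in> {0..<d}" for s
    proof -
      have "relay u s = relay v s"
        using rel[of s] rel[of t] \<epsilon>1(3)[of s] \<epsilon>2(3)[of s] that t(1)
        by (cases "s \<le> t") (auto simp: d_def)
      then show ?thesis using zu[of s] zv[of s] that d by simp
    qed
    have "u s = v s" if "s \<in> {0..d}" for s
    proof (rule solves_unique_forcing[OF _ solves_initial[OF u d] solves_initial[OF v d] _ that])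
      show "forcing z integrable_on {0..d}"
        using integrable_on_subinterval[OF z, of 0 d] d by simp
    qed (simp add: forcing_def zz)
    then show ?thesis
      using \<epsilon>1(1) \<epsilon>2(1) t(1) by (intro exI[of _ "min \<epsilon>1 \<epsilon>2"]) (auto simp: d_def)
  qed
qed

section \<open>Existence of a closed-loop control\<close>

definition closed_loop :: "(real \<Rightarrow> real) \<Rightarrow> real \<Rightarrow> bool" where
  "closed_loop z c \<longleftrightarrow> control z \<and> (\<forall>t\<in>{0..c}. z t = relay (response z) t)"

text \<open>Uniqueness of the responses on the common interval makes controls for different horizons
  consistent, so that they can be glued.\<close>

lemma closed_loop_agree:
  assumes "closed_loop z c" "closed_loop z' c'" "0 \<le> t" "t \<le> c" "t \<le> c'"
  shows "z t = z' t"
proof -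
  have z: "control z" "control z'" using assms by (auto simp: closed_loop_def)
  have "response z s = response z' s" if "s \<in> {0..t}" for s
    by (rule closed_loop_unique[OF solves_response[OF z(1)] solves_response[OF z(2)]
          forcing_integrable[OF z(1)] _ _ assms(3) that])
      (use assms in \<open>auto simp: closed_loop_def\<close>)
  then have "relay (response z) t = relay (response z') t"
    by (intro hysteresis_cong[OF thresholds continuous_on_M_response[OF z(1)] _ assms(3)]) simp
  then show ?thesis using assms by (simp add: closed_loop_def)
qed

text \<open>Gluing along increasing horizons, used both for a limit of times from the left and for
  the whole half-line. The glued control is measurable as a pointwise limit.\<close>

lemma closed_loop_limit:
  assumes "incseq r" and ex: "\<And>n. \<exists>z. closed_loop z (r n)"
  obtains z where "control z" "\<And>t n. 0 \<le> t \<Longrightarrow> t \<le> r n \<Longrightarrow> z t = relay (response z) t"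
proof -
  obtain \<zeta> where \<zeta>: "\<And>n. closed_loop (\<zeta> n) (r n)" using ex by metis
  \<comment> \<open>The cut-off to 0 makes the sequence converge at every real time, also outside
    the union of the intervals.\<close>
  define \<xi> where "\<xi> n t = (if t \<in> {0..r n} then \<zeta> n t else 0)" for n t
  \<comment> \<open>The least index is an arbitrary choice; by \<open>closed_loop_agree\<close>
    every admissible index gives the same value.\<close>
  define z where "z t = (if \<exists>n. t \<in> {0..r n} then \<xi> (LEAST n. t \<in> {0..r n}) t else 0)" for t
  have z_eq: "z t = \<zeta> n t" if "0 \<le> t" "t \<le> r n" for t n
  proof -
    let ?l = "LEAST n. t \<in> {0..r n}"
    have *: "t \<in> {0..r n}" using that by simp
    have l: "t \<in> {0..r ?l}" by (rule LeastI[of "\<lambda>n. t \<in> {0..r n}", OF *])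
    have "z t = \<zeta> ?l t" unfolding z_def \<xi>_def using * l by (simp only: if_True) metis
    also have "\<dots> = \<zeta> n t"
      using l that by (intro closed_loop_agree[OF \<zeta> \<zeta>]) auto
    finally show ?thesis .
  qed
  have lim: "(\<lambda>n. \<xi> n t) \<longlonglongrightarrow> z t" for t
  proof (cases "\<exists>n. t \<in> {0..r n}")
    case True
    then obtain n where n: "t \<in> {0..r n}" by blast
    have "\<xi> m t = z t" if "n \<le> m" for m
    proof -
      have "t \<le> r m" using n incseqD[OF \<open>incseq r\<close> that] by simp
      then show ?thesis using n z_eq[of t m] by (simp add: \<xi>_def)
    qed
    then show ?thesis
      by (intro tendsto_eventually) (auto simp: eventually_sequentially)
  next
    case False
    then have "\<xi> n t = 0" "z t = 0" for n by (auto simp: \<xi>_def z_def)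
    then show ?thesis by simp
  qed
  have "z \<in> borel_measurable borel"
  proof (rule borel_measurable_LIMSEQ_real[OF lim])
    show "\<xi> n \<in> borel_measurable borel" for n
    proof -
      have [measurable]: "\<zeta> n \<in> borel_measurable borel"
        using \<zeta>[of n] by (simp add: closed_loop_def control_def)
      show ?thesis unfolding \<xi>_def[abs_def] by measurable
    qed
  qed
  moreover have "\<bar>z t\<bar> \<le> 1" for t
  proof (cases "\<exists>n. t \<in> {0..r n}")
    case True
    then obtain n where "0 \<le> t" "t \<le> r n" by auto
    then have "z t = \<zeta> n t" by (rule z_eq)
    moreover have "\<bar>\<zeta> n t\<bar> \<le> 1" using \<zeta>[of n] by (simp only: closed_loop_def control_def)
    ultimately show ?thesis by simp
  next
    case False
    then have "z t = 0" by (simp only: z_def if_False)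
    then show ?thesis by simp
  qed
  ultimately have z: "control z" by (simp add: control_def)
  have "z t = relay (response z) t" if "0 \<le> t" "t \<le> r n" for t n
  proof -
    \<comment> \<open>\<open>z\<close> and \<open>\<zeta> n\<close> coincide on
      \<open>[0,r n]\<close>, so causality applies.\<close>
    have "relay (response (\<zeta> n)) t = relay (response z) t"
      using z \<zeta>[of n] that z_eq[of _ n]
      by (intro relay_response_causal) (auto simp: closed_loop_def)
    then show ?thesis using z_eq[OF that] \<zeta>[of n] that by (simp add: closed_loop_def)
  qed
  with z that show ?thesis by blast
qed

lemma closed_loop_extend:
  assumes z: "closed_loop z S" and "0 \<le> S"
  obtains \<epsilon> z' where "0 < \<epsilon>" "closed_loop z' (S + \<epsilon>)"
proof -
  define z' where "z' t = (if t \<le> S then z t else z S)" for t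
  have zc: "control z" using z by (simp add: closed_loop_def)
  then have [measurable]: "z \<in> borel_measurable borel" by (simp add: control_def)
  have "z' \<in> borel_measurable borel" unfolding z'_def[abs_def] by measurable
  then have z'c: "control z'" using zc by (auto simp: control_def z'_def)
  have upto: "relay (response z') t = z' t" if "t \<in> {0..S}" for t
  proof -
    have "relay (response z) t = relay (response z') t"
      using that by (intro relay_response_causal[OF zc z'c]) (auto simp: z'_def)
    then show ?thesis using z that by (simp add: closed_loop_def z'_def)
  qed
  obtain \<epsilon> where \<epsilon>: "0 < \<epsilon>" "\<And>t. t \<in> {S..S+\<epsilon>} \<Longrightarrow> relay (response z') t = relay (response z') S"
    using hysteresis_right_constant[OF thresholds continuous_on_M_response[OF z'c] \<open>0 \<le> S\<close>, of "S + 1"]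
    by auto
  have "z' t = relay (response z') t" if "t \<in> {0..S+\<epsilon>}" for t
  proof (cases "t \<le> S")
    case True
    then show ?thesis using upto[of t] that by simp
  next
    case False
    then have "relay (response z') t = z' S" using \<epsilon>(2)[of t] upto[of S] that \<open>0 \<le> S\<close> by simp
    then show ?thesis using False by (simp add: z'_def)
  qed
  then have "closed_loop z' (S + \<epsilon>)" using z'c by (simp add: closed_loop_def)
  with \<epsilon>(1) that show ?thesis by blast
qed

text \<open>The induction runs over the horizon itself: prolongation gives the step to the right,
  gluing the limit from the left.\<close>

lemma closed_loop_exists_upto:
  assumes "0 \<le> c"
  shows "\<exists>z. closed_loop z c"
proof (rule interval_induct[where P="\<lambda>c. \<exists>z. closed_loop z c", OF assms])
  show "\<exists>z. closed_loop z 0"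
  proof
    \<comment> \<open>At horizon 0 only the input at time 0 matters, and every response starts at
      \<open>x\<close>.\<close>
    define z where "z = (\<lambda>t::real. relay (\<lambda>_. x) 0)"
    have zc: "control z"
      using hysteresis_values[OF thresholds, of "\<lambda>_. M x" 0] by (auto simp: control_def z_def)
    have "response z 0 = x" using solves_0[OF solves_response[OF zc, of 0]] by simp
    then have "relay (\<lambda>_. x) 0 = relay (response z) 0"
      by (intro hysteresis_cong[OF thresholds]) auto
    then show "closed_loop z 0" using zc by (simp add: closed_loop_def z_def)
  qed
  show "\<exists>\<epsilon>>0. \<forall>s\<in>{t..t+\<epsilon>}. s \<le> c \<longrightarrow> (\<exists>z. closed_loop z s)"
    if "0 \<le> t" "t < c" and ih: "\<And>s. s \<in> {0..t} \<Longrightarrow> \<exists>z. closed_loop z s" for t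
  proof -
    obtain z where "closed_loop z t" using ih[of t] \<open>0 \<le> t\<close> by auto
    then obtain \<epsilon> z' where "0 < \<epsilon>" "closed_loop z' (t + \<epsilon>)"
      using closed_loop_extend \<open>0 \<le> t\<close> by blast
    then have "\<forall>s\<in>{t..t+\<epsilon>}. closed_loop z' s" by (auto simp: closed_loop_def)
    with \<open>0 < \<epsilon>\<close> show ?thesis by blast
  qed
  show "\<exists>z. closed_loop z t"
    if t: "0 < t" "t \<le> c" and ih: "\<And>s. s \<in> {0..<t} \<Longrightarrow> \<exists>z. closed_loop z s" for t
  proof -
    \<comment> \<open>These times start at 0 and increase to \<open>t\<close> while staying below
      it, so the induction hypothesis covers them.\<close>
    define r where "r n = t - t / real (Suc n)" for n
    have "incseq r"
      using t by (intro incseq_SucI) (auto simp: r_def field_simps)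
    moreover have "\<exists>z. closed_loop z (r n)" for n
      using t by (intro ih) (auto simp: r_def field_simps)
    ultimately obtain z where zc: "control z"
      and z: "\<And>s n. 0 \<le> s \<Longrightarrow> s \<le> r n \<Longrightarrow> z s = relay (response z) s"
      using closed_loop_limit by blast
    have z_lt: "z s = relay (response z) s" if s: "0 \<le> s" "s < t" for s
    proof -
      have "r \<longlonglongrightarrow> t - t * 0"
        unfolding r_def divide_inverse by (intro tendsto_intros LIMSEQ_inverse_real_of_nat)
      then have "eventually (\<lambda>n. s < r n) sequentially"
        using s(2) by (intro order_tendstoD) auto
      then obtain n where "s < r n" by (auto simp: eventually_sequentially)
      then show ?thesis using z[of s n] s by simp
    qed
    \<comment> \<open>Gluing settles the control before \<open>t\<close> only. Its value at
      \<open>t\<close> is set to the relay state there, which by strict causality does not change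
      under this redefinition.\<close>
    define z' where "z' s = (if s = t then relay (response z) t else z s)" for s
    have [measurable]: "z \<in> borel_measurable borel" using zc by (simp add: control_def)
    have "z' \<in> borel_measurable borel" unfolding z'_def[abs_def] by measurable
    then have z'c: "control z'"
      using zc hysteresis_values[OF thresholds, of "\<lambda>t. M (response z t)" t]
      by (auto simp: control_def z'_def)
    have "z' s = relay (response z') s" if s: "s \<in> {0..t}" for s
    proof -
      have "relay (response z) s = relay (response z') s"
        using s by (intro relay_response_causal[OF zc z'c]) (auto simp: z'_def)
      then show ?thesis using z_lt[of s] s by (auto simp: z'_def)
    qed
    then show ?thesis using z'c by (auto simp: closed_loop_def)
  qed
  show "c \<in> {0..c}" using assms by simp
qed

lemma closed_loop_exists:
  obtains z where "control z" "\<And>t. 0 \<le> t \<Longrightarrow> z t = relay (response z) t"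
proof -
  obtain z where z: "control z" "\<And>t n. 0 \<le> t \<Longrightarrow> t \<le> real n \<Longrightarrow> z t = relay (response z) t"
    using closed_loop_limit[of real] closed_loop_exists_upto by (auto simp: incseq_def)
  have "z t = relay (response z) t" if "0 \<le> t" for t
    using z(2)[OF that] real_arch_simple by blast
  with z(1) that show ?thesis by blast
qed

end

section \<open>The hysteresis-delay problem in its weak form\<close>

lemma linear_lin_functional: "linear (lin_functional e m :: real ^ 'n \<Rightarrow> real)"
  by (rule linearI)
    (auto simp: lin_functional_def algebra_simps sum.distrib sum_distrib_left)

theorem theorem2p7:
  fixes p T \<alpha> \<beta> :: real
    and k x :: "real ^ 'n"
    and A B :: "real ^ 'n ^ 'n"
    and e :: "nat \<Rightarrow> 'n"
    and m :: "nat \<Rightarrow> real"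
    and \<phi> :: "real \<Rightarrow> real ^ 'n"
  assumes "1 < p" and "0 < T" and "\<alpha> < \<beta>"
    and "bij_betw e {1..CARD('n)} UNIV"
    and "m 0 \<noteq> 0"
    and "\<phi> \<in> Lp_vec p (- 2 * T) 0"
  shows "\<exists>u. solution p T \<alpha> \<beta> k A B (lin_functional e m) \<phi> x u \<and>
           (\<forall>v. solution p T \<alpha> \<beta> k A B (lin_functional e m) \<phi> x v \<longrightarrow>
              (AE t in lebesgue_on {- 2 * T<..}. v t = u t))"
proof -
  note p = \<open>1 < p\<close> and T = \<open>0 < T\<close>
  define M where "M = (lin_functional e m :: real ^ 'n \<Rightarrow> real)"
  define \<phi>0 where "\<phi>0 t = (if t \<in> {- 2 * T<..<0} then \<phi> t else 0)" for t
  have \<phi>0: "\<phi>0 \<in> Lp_vec p a b" for a b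
    unfolding \<phi>0_def[abs_def] using assms(6) by (rule Lp_vec_zero_extension)
  \<comment> \<open>For \<open>0 < s < 2 * T\<close> this is the delay term with the initial
    function inserted, elsewhere it is 0. It complements the delay term of \<open>rhs\<close>, which
    begins at \<open>2 * T\<close>.\<close>
  define f where "f s = A *v \<phi>0 (s - 2 * T)" for s
  have "(\<lambda>s. \<phi>0 (s - 2 * T)) \<in> Lp_vec p 0 c" for c
    using Lp_vec_shift[OF \<phi>0[of "- 2 * T" "c - 2 * T"], of "2 * T"] by simp
  then have f: "f \<in> Lp_vec p 0 c" for c
    unfolding f_def[abs_def] using p by (intro Lp_vec_matrix_mult) auto
  interpret hysteresis_system T A B x \<alpha> \<beta> k M f
  proof (intro hysteresis_system.intro delay_system.intro hysteresis_system_axioms.intro)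
    show "f integrable_on {0..c}" for c
      using Lp_vec_imp_integrable_on[OF f] p by simp
    show "linear M" unfolding M_def by (rule linear_lin_functional)
  qed fact+
  obtain z where z: "control z" and zr: "\<And>t. 0 \<le> t \<Longrightarrow> z t = relay (response z) t"
    using closed_loop_exists by blast
  define y where "y = response z"
  have y: "solves (forcing z) y c" for c unfolding y_def by (rule solves_response[OF z])
  note yc = solves_continuous_on[OF y]
  \<comment> \<open>At time 0 this gives 0 rather than the trace \<open>x\<close>; a single point
    does not matter for the equivalence class.\<close>
  define u where "u t = \<phi>0 t + (if 0 < t then y t else 0)" for t
  have u_pos: "u t = y t" if "0 < t" for t using that by (simp add: u_def \<phi>0_def)
  have u_neg: "u t = \<phi> t" if "t \<in> {- 2 * T<..<0}" for t using that by (simp add: u_def \<phi>0_def)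
  have "solution_upto p T \<alpha> \<beta> k A B M \<phi> x T1 u" if T1: "0 < T1" for T1
  proof -
    have uLp: "u \<in> Lp_vec p (- 2 * T) T1"
    proof -
      have "(\<lambda>t. if t \<in> {0<..<T1} then y t else 0) \<in> Lp_vec p (- 2 * T) T1"
        using p by (intro Lp_vec_zero_extension continuous_in_Lp_vec yc) auto
      then have "(\<lambda>t. \<phi>0 t + (if t \<in> {0<..<T1} then y t else 0)) \<in> Lp_vec p (- 2 * T) T1"
        using p by (intro Lp_vec_add \<phi>0) auto
      moreover have "(\<lambda>t. u t $ i) \<in> Lp p (- 2 * T) T1 \<longleftrightarrow>
          (\<lambda>t. (\<phi>0 t + (if t \<in> {0<..<T1} then y t else 0)) $ i) \<in> Lp p (- 2 * T) T1" for i
        by (rule Lp_cong) (auto simp: u_def)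
      ultimately show ?thesis by (simp add: Lp_vec_def)
    qed
    define w where "w s = z s *\<^sub>R k - B *v u s + A *v u (s - 2 * T)" for s
    have wLp: "w \<in> Lp_vec p 0 T1"
    proof -
      have zb: "z \<in> borel_measurable lebesgue"
        using z by (simp add: control_def measurable_completion)
      have "(\<lambda>s. z s *\<^sub>R k) \<in> Lp_vec p 0 T1"
        unfolding Lp_vec_def
      proof (intro CollectI allI)
        fix i
        have "z \<in> Lp p 0 T1"
          using z p measurable_restrict_space1[OF zb]
          by (intro bounded_measurable_in_Lp[where C=1]) (auto simp: control_def)
        from Lp_cmult[OF this, of "k $ i"] show "(\<lambda>s. (z s *\<^sub>R k) $ i) \<in> Lp p 0 T1"
          by (simp add: mult.commute)
      qed
      moreover have "(\<lambda>s. (- B) *v u s) \<in> Lp_vec p 0 T1"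
        using p T Lp_vec_subinterval[OF uLp] by (intro Lp_vec_matrix_mult) auto
      moreover have "(\<lambda>s. A *v u (s - 2 * T)) \<in> Lp_vec p 0 T1"
        using p T Lp_vec_subinterval[OF Lp_vec_shift[OF uLp, of "2 * T"], of 0 T1]
        by (intro Lp_vec_matrix_mult) auto
      ultimately have "(\<lambda>s. z s *\<^sub>R k + (- B) *v u s + A *v u (s - 2 * T)) \<in> Lp_vec p 0 T1"
        using p by (intro Lp_vec_add) auto
      moreover have "(\<lambda>s. z s *\<^sub>R k + (- B) *v u s + A *v u (s - 2 * T)) = w"
        by (simp add: w_def fun_eq_iff vec_eq_iff matrix_vector_mult_def sum_negf)
      ultimately show ?thesis by simp
    qed
    have yw: "y t = x + integral {0..t} w" if "t \<in> {0..T1}" for t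
    proof -
      have "integral {0..t} w = integral {0..t} (rhs (forcing z) y)"
      proof (rule integral_spike)
        \<comment> \<open>At these two times \<open>w\<close> reads \<open>u 0 = 0\<close>, directly
          or through the delay, where \<open>rhs\<close> reads \<open>y 0 = x\<close>.\<close>
        show "negligible {0, 2 * T}" by (simp add: negligible_finite)
        show "rhs (forcing z) y s = w s" if "s \<in> {0..t} - {0, 2 * T}" for s
          using that by (auto simp: w_def rhs_def forcing_def f_def u_def \<phi>0_def algebra_simps)
      qed
      then show ?thesis using y[of T1] that by (simp add: solves_def)
    qed
    have sd: "sobolev_deriv_vec p 0 T1 u w"
      using p yw u_pos by (intro primitive_imp_sobolev_deriv_vec[OF _ T1 wLp]) auto
    have rep: "continuous_rep 0 T1 u y"
      unfolding continuous_rep_def using yc[of T1] u_pos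
      by (auto intro!: AE_I2)
    have Mrep: "continuous_rep 0 T1 (\<lambda>t. M (u t)) (\<lambda>t. M (y t))"
      unfolding continuous_rep_def using continuous_on_M[OF yc[of T1]] u_pos
      by (auto intro!: AE_I2)
    have "AE t in lebesgue_on {0<..<T1}.
       w t = relay y t *\<^sub>R k - B *v u t + A *v u (t - 2 * T)"
      using zr by (intro AE_I2) (simp add: w_def y_def)
    moreover have "AE t in lebesgue_on {- 2 * T<..<0}. u t = \<phi> t"
      using u_neg by (intro AE_I2) simp
    moreover have "right_trace 0 T1 u x"
      using rep solves_0[OF y[of T1]] T1 unfolding right_trace_def by auto
    moreover have "u \<in> W1p_vec p 0 T1"
      using sd by (auto simp: W1p_vec_def W1p_def sobolev_deriv_vec_def)
    ultimately show ?thesis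
      using uLp sd Mrep unfolding solution_upto_def by blast
  qed
  then have existence: "solution p T \<alpha> \<beta> k A B M \<phi> x u" by (simp add: solution_def)
  have "AE t in lebesgue_on {- 2 * T<..}. v t = u t"
    if sol_v: "solution p T \<alpha> \<beta> k A B M \<phi> x v" for v
  proof -
    have ex: "\<exists>N. negligible N \<and> (\<forall>t\<in>{- 2 * T<..<T1} - N. v t = u t)" if T1: "0 < T1" for T1
    proof -
      have "solution_upto p T \<alpha> \<beta> k A B M \<phi> x T1 v"
        using sol_v T1 by (simp add: solution_def)
      then obtain w g where sd: "sobolev_deriv_vec p 0 T1 v w"
        and g: "continuous_rep 0 T1 (\<lambda>t. M (v t)) g"
        and eq: "AE t in lebesgue_on {0<..<T1}.
           w t = hysteresis \<alpha> \<beta> g t *\<^sub>R k - B *v v t + A *v v (t - 2 * T)"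
        and v\<phi>: "AE t in lebesgue_on {- 2 * T<..<0}. v t = \<phi> t" and tr: "right_trace 0 T1 v x"
        unfolding solution_upto_def by blast
      \<comment> \<open>This is the continuous representative of \<open>v\<close> on
        \<open>[0,T1]\<close>. Its relay state is the one in the equation, because
        \<open>g t\<close> and \<open>M (q t)\<close> are continuous and agree almost
        everywhere.\<close>
      define q where "q t = x + integral {0..t} w" for t
      have wi: "w integrable_on {0..T1}" and vq: "AE t in lebesgue_on {0<..<T1}. v t = q t"
        using sobolev_deriv_vec_imp_primitive[OF _ T1 sd tr] p by (auto simp: q_def)
      have qc: "continuous_on {0..T1} q"
        unfolding q_def by (intro continuous_intros indefinite_integral_continuous_1 wi)
      have gc: "continuous_on {0..T1} g" using g by (simp add: continuous_rep_def)
      have gq: "g t = M (q t)" if "t \<in> {0..T1}" for t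
      proof (rule continuous_AE_eq_imp_eq[OF T1 gc continuous_on_M[OF qc] _ that])
        have "AE t in lebesgue_on {0<..<T1}. g t = M (v t)" using g by (simp add: continuous_rep_def)
        with vq show "AE t in lebesgue_on {0<..<T1}. g t = M (q t)" by eventually_elim simp
      qed
      obtain N1 where N1: "negligible N1" "\<And>t. t \<in> {0<..<T1} - N1 \<Longrightarrow> v t = q t"
        using vq by (auto simp: AE_lebesgue_on_iff_negligible)
      obtain N2 where N2: "negligible N2" "\<And>t. t \<in> {- 2 * T<..<0} - N2 \<Longrightarrow> v t = \<phi> t"
        using v\<phi> by (auto simp: AE_lebesgue_on_iff_negligible)
      obtain N3 where N3: "negligible N3" "\<And>t. t \<in> {0<..<T1} - N3 \<Longrightarrow>
          w t = hysteresis \<alpha> \<beta> g t *\<^sub>R k - B *v v t + A *v v (t - 2 * T)"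
        using eq by (auto simp: AE_lebesgue_on_iff_negligible)
      \<comment> \<open>Translating by \<open>2 * T\<close> the sets where \<open>v\<close> differs
        from \<open>q\<close> or \<open>\<phi>\<close> removes the bad delayed times. The points 0
        and \<open>T1\<close> are the endpoints, and \<open>2 * T\<close> has delayed time
        0.\<close>
      define N where "N = N1 \<union> N3 \<union> (+) (2 * T) ` (N1 \<union> N2) \<union> {0, 2 * T, T1}"
      have N: "negligible N"
        unfolding N_def using negligible_finite[of "{0, 2 * T, T1}"]
        by (intro negligible_Un negligible_translation N1(1) N2(1) N3(1)) auto
      have rel: "hysteresis \<alpha> \<beta> g t = relay q t" if "t \<in> {0..T1}" for t
        using that gq by (intro hysteresis_cong[OF thresholds continuous_on_subset[OF gc]]) auto
      have wq: "w s = rhs (forcing (relay q)) q s" if s: "s \<in> {0..T1} - N" for s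
      proof -
        have s1: "s \<in> {0<..<T1}" "s \<notin> N1" "s \<notin> N3" "s \<noteq> 2 * T" using s by (auto simp: N_def)
        have "s \<noteq> 2 * T + r" if "r \<in> N1 \<union> N2" for r
          using s that by (auto simp: N_def)
        from this[of "s - 2 * T"] have s2: "s - 2 * T \<notin> N1" "s - 2 * T \<notin> N2"
          by auto
        \<comment> \<open>Before \<open>2 * T\<close> the delayed time is negative and
          \<open>v\<close> equals \<open>\<phi>\<close> there; after it the delayed time lies in
          \<open>(0,T1)\<close>, where \<open>v\<close> equals \<open>q\<close>.\<close>
        have "v (s - 2 * T) = \<phi>0 (s - 2 * T) + (if s \<in> {2 * T..} then q (s - 2 * T) else 0)"
        proof (cases "s < 2 * T")
          case True
          then show ?thesis using N2(2)[of "s - 2 * T"] s1 s2 by (simp add: \<phi>0_def)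
        next
          case False
          then show ?thesis using N1(2)[of "s - 2 * T"] s1 s2 T by (simp add: \<phi>0_def)
        qed
        then have "A *v v (s - 2 * T) = f s + (if s \<in> {2 * T..} then A *v q (s - 2 * T) else 0)"
          by (simp add: f_def matrix_vector_right_distrib)
        then show ?thesis
          using N3(2)[of s] N1(2)[of s] rel[of s] s1 by (simp add: rhs_def forcing_def)
      qed
      have q: "solves (forcing (relay q)) q T1"
      proof -
        have "integral {0..t} w = integral {0..t} (rhs (forcing (relay q)) q)" if "t \<in> {0..T1}" for t
          using that wq by (intro integral_spike[OF N]) auto
        then show ?thesis using qc by (simp add: solves_def q_def)
      qed
      \<comment> \<open>The two functions enter asymmetrically: \<open>y\<close> supplies the
        integrable forcing, while \<open>q\<close> brings its own relay state as control, whose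
        measurability has not been established.\<close>
      have "y t = q t" if "t \<in> {0..T1}" for t
        using T1 that zr
        by (intro closed_loop_unique[OF y q forcing_integrable[OF z]]) (auto simp: y_def)
      then have "v t = u t" if "t \<in> {- 2 * T<..<T1} - (N1 \<union> N2 \<union> {0})" for t
        using that N1(2)[of t] N2(2)[of t] u_pos[of t] u_neg[of t] by (cases "t < 0") auto
      moreover have "negligible (N1 \<union> N2 \<union> {0})" using N1(1) N2(1) by (intro negligible_Un) auto
      ultimately show ?thesis by blast
    qed
    \<comment> \<open>The horizons \<open>Suc n\<close> are positive and exhaust the half-line, and
      a countable union of null sets is null.\<close>
    have "\<forall>n. \<exists>N. negligible N \<and> (\<forall>t\<in>{- 2 * T<..<real (Suc n)} - N. v t = u t)"
      using ex by simp
    then obtain N where N: "\<And>n. negligible (N n)"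
      "\<And>n t. t \<in> {- 2 * T<..<real (Suc n)} - N n \<Longrightarrow> v t = u t"
      by metis
    have "v t = u t" if t: "t \<in> {- 2 * T<..} - (\<Union>n. N n)" for t
    proof -
      obtain n where "t < real n" using reals_Archimedean2 by blast
      then show ?thesis using N(2)[of t n] t by simp
    qed
    moreover have "negligible (\<Union>n. N n)" using N(1) by (intro negligible_countable_Union) auto
    ultimately show ?thesis
      by (subst AE_lebesgue_on_iff_negligible) auto
  qed
  with existence show ?thesis unfolding M_def by blast
qed

end
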